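(* Let $(\mathcal A,[\cdot_\lambda\cdot],\cdot_\lambda\cdot,\omega_\lambda(\cdot,\cdot))$ be a generalized pseudo-Hessian post-Lie conformal algebra. Then there is a partial-pre-post-Lie conformal algebra structure $(\mathcal A,[\cdot_\lambda\cdot],\lhd_\lambda,\rhd_\lambda)$ on $\mathcal A$, where $\lhd_\lambda$ and $\rhd_\lambda$ are defined by $$\omega_\lambda(a\lhd_\mu b,c)=\omega_\mu(a,c_{-\lambda}b),\qquad \omega_\lambda(a\rhd_\mu b,c)=-\omega_{\lambda-\mu}(b,\,a_\mu c-c_{-\mu-\partial}a),\qquad\forall a,b,c\in\mathcal A.$$ Moreover, if $\omega_\lambda(\cdot,\cdot)$ is left-invariant, then $(\mathcal A,[\cdot_\lambda\cdot],\lhd_\lambda,\rhd_\lambda)$ is special.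
   Context: $\mathbf k$ is a field of characteristic zero; all $\mathbf k[\partial]$-modules are finitely generated. Subscripts containing $\partial$ mean that the variable is replaced by the operator acting from the left on the coefficients of the $\lambda$-product in question. A $\mathbf k$-bilinear $\lambda$-product $\ast_\lambda:\mathcal A\times\mathcal A\to\mathcal A[\lambda]$ satisfies conformal sesquilinearity if $(\partial a)\ast_\lambda b=-\lambda\,a\ast_\lambda b$, $a\ast_\lambda(\partial b)=(\lambda+\partial)(a\ast_\lambda b)$. A Lie conformal algebra is a $\mathbf k[\partial]$-module $\mathcal A$ with a conformally sesquilinear $[\cdot_\lambda\cdot]$ with $[a_\lambda b]=-[b_{-\lambda-\partial}a]$ and $[a_\lambda[b_\mu c]]=[[a_\lambda b]_{\lambda+\mu}c]+[b_\mu[a_\lambda c]]$. A post-Lie conformal algebra $(\mathcal A,[\cdot_\lambda\cdot],\cdot_\lambda\cdot)$ is a Lie conformal algebra with a conformally sesquilinear product $a_\lambda b$ satisfying $(a_\lambda b)_{\lambda+\mu}c-(b_\mu a)_{\lambda+\mu}c+[a_\lambda b]_{\lambda+\mu}c+b_\mu(a_\lambda c)-a_\lambda(b_\mu c)=0$ and $a_\lambda[b_\mu c]=[(a_\lambda b)_{\lambda+\mu}c]+[b_\mu(a_\lambda c)]$. A conformal bilinear form is a $\mathbf k$-bilinear $\omega_\lambda:\mathcal A\times\mathcal A\to\mathbf k[\lambda]$ with $\omega_\lambda(\partial a,b)=-\lambda\omega_\lambda(a,b)$, $\omega_\lambda(a,\partial b)=\lambda\omega_\lambda(a,b)$; symmetric: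 $\omega_\lambda(a,b)=\omega_{-\lambda}(b,a)$; non-degenerate: $a\mapsto\omega_\lambda(a,\cdot)$ is a $\mathbf k[\partial]$-module isomorphism from $\mathcal A$ onto $\mathcal A^{*c}$, the module of $\mathbf k$-linear maps $f:\mathcal A\to\mathbf k[\lambda]$ with $f_\lambda(\partial a)=\lambda f_\lambda a$ and $(\partial f)_\lambda=-\lambda f_\lambda$. On a post-Lie conformal algebra it is invariant if (i) $\omega_\lambda([a_\mu b],c)=\omega_\mu(a,[b_{\lambda-\mu}c])$ and (ii) $\omega_{\lambda+\mu}(a_\lambda b,c)-\omega_\lambda(a,b_\mu c)=\omega_{\lambda+\mu}(b_\mu a,c)-\omega_\mu(b,a_\lambda c)$; it is left-invariant if (i) holds and $\omega_{\lambda+\mu}(a_\lambda b,c)+\omega_\mu(b,a_\lambda c)=0$. A generalized pseudo-Hessian post-Lie conformal algebra is a post-Lie conformal algebra with a non-degenerate symmetric invariant conformal bilinear form. A partial-pre-post-Lie conformal algebra (pp-post-Lie conformal algebra) $(\mathcal A,[\cdot_\lambda\cdot],\lhd_\lambda,\rhd_\lambda)$ is a Lie conformal algebra with two conformally sesquilinear products $\lhd_\lambda,\rhd_\lambda:\mathcal A\times\mathcal A\to\mathcal A[\lambda]$ such that for all $a,b,c$: 1. $a\lhd_\lambda[b_\mu c]=[a_\lambda b]\lhd_{\lambda+\mu}c-[a_\lambda c]\lhd_{-\mu-\partial}b$; 2. $[a_\lambda(b\lhd_\mu c+c\lhd_{-\mu-\partial}b)]=[a_\lambda c]\lhd_{-\mu-\partial}b+b\lhd_\mu[a_\lambda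 c]$; 3. $a\rhd_\lambda[b_\mu c]-[b_\mu c]\lhd_{-\lambda-\partial}a=[(a\rhd_\lambda b+a\lhd_\lambda b)_{\lambda+\mu}c]+[b_\mu(a\rhd_\lambda c-c\lhd_{-\lambda-\partial}a)]$; 4. $\{a_\lambda b\}\rhd_{\lambda+\mu}c=a\rhd_\lambda(b\rhd_\mu c)-b\rhd_\mu(a\rhd_\lambda c)+[b_\mu(a\lhd_\lambda c)]-[a_\lambda(b\lhd_\mu c)]-[a_\lambda b]\lhd_{\lambda+\mu}c$; 5. $(a\rhd_\lambda b-b\lhd_\mu a)\lhd_{\lambda+\mu}c+b\lhd_\mu(a\rhd_\lambda c+a\lhd_\lambda c)=a\rhd_\lambda(b\lhd_\mu c)+[a_\lambda(b\lhd_\mu c)]$; where $\{a_\lambda b\}=a\rhd_\lambda b+a\lhd_\lambda b-b\rhd_{-\lambda-\partial}a-b\lhd_{-\lambda-\partial}a+[a_\lambda b]$. It is special if $a\lhd_\lambda b=-b\lhd_{-\lambda-\partial}a$ for all $a,b$. *)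

theory Defs
  imports
    "HOL-Computational_Algebra.Polynomial"
    "HOL-Library.Function_Algebras"
begin

text \<open>
  For an additive group \<open>M\<close>, an element of \<open>M[\<lambda>]\<close> is a \<open>'m poly\<close>, and an element of
  \<open>M[\<lambda>,\<mu>]\<close> is a \<open>'m poly poly\<close> whose inner variable is \<open>\<lambda>\<close> and whose outer variable
  is \<open>\<mu>\<close>. The variables act on \<open>M[\<lambda>,\<mu>]\<close> by multiplication. A subscript such as
  \<open>-\<mu> - \<partial>\<close> is an additive operator on \<open>M[\<lambda>,\<mu>]\<close>; sums and negatives of operators are
  taken pointwise.
\<close>

abbreviation const2 :: "'m::zero \<Rightarrow> 'm poly poly" ("\<kappa>")
  where "\<kappa> a \<equiv> [:[:a:]:]"

definition lam :: "'m::zero poly poly \<Rightarrow> 'm poly poly"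
  where "lam P = map_poly (pCons 0) P"

definition mu :: "'m::zero poly poly \<Rightarrow> 'm poly poly"
  where "mu P = pCons 0 P"

text \<open>The operator \<open>\<partial>\<close>, for a \<open>\<^bold>k[\<partial>]\<close>-module given as a module over \<open>'k poly\<close>.\<close>

definition D :: "('k::comm_ring_1 poly \<Rightarrow> 'a \<Rightarrow> 'a) \<Rightarrow> 'a::ab_group_add \<Rightarrow> 'a"
  where "D scale = scale [:0, 1:]"

definition del :: "('k::comm_ring_1 poly \<Rightarrow> 'a \<Rightarrow> 'a) \<Rightarrow> 'a::ab_group_add poly poly \<Rightarrow> 'a poly poly"
  where "del scale = map_poly (map_poly (D scale))"

text \<open>Replace the variable of \<open>p\<close> by the operator \<open>T\<close>: \<open>\<Sum>\<^sub>n T\<^sup>n p\<^sub>n\<close>.\<close>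

definition subst_op ::
    "('m::comm_monoid_add poly poly \<Rightarrow> 'm poly poly) \<Rightarrow> 'm poly \<Rightarrow> 'm poly poly"
  where "subst_op T p = (\<Sum>n\<le>degree p. (T ^^ n) (\<kappa> (coeff p n)))"

text \<open>
  \<open>P \<star>\<^bsub>f,T\<^esub> Q\<close> is \<open>P f\<^sub>T Q\<close>: the product (or form) \<open>f\<close> with its variable replaced by
  \<open>T\<close>, extended to \<open>M[\<lambda>,\<mu>]\<close> bilinearly over the coefficients \<open>\<lambda>\<close>, \<open>\<mu>\<close>. If \<open>T\<close> contains
  \<open>\<partial>\<close>, it acts on the coefficients of this product only, not on those of \<open>P\<close>, \<open>Q\<close>.
\<close>

definition ext ::
    "'a::zero poly poly \<Rightarrow> ('a \<Rightarrow> 'a \<Rightarrow> 'm::comm_monoid_add poly) \<Rightarrow>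
     ('m poly poly \<Rightarrow> 'm poly poly) \<Rightarrow> 'a poly poly \<Rightarrow> 'm poly poly"
    ("(_ \<star>\<^bsub>_,_\<^esub> _)" [76, 0, 0, 76] 75)
  where "P \<star>\<^bsub>f,T\<^esub> Q =
    (\<Sum>j\<le>degree P. \<Sum>i\<le>degree (coeff P j). \<Sum>l\<le>degree Q. \<Sum>k\<le>degree (coeff Q l).
       (lam ^^ (i + k)) ((mu ^^ (j + l))
         (subst_op T (f (coeff (coeff P j) i) (coeff (coeff Q l) k)))))"

text \<open>
  Here and below, \<open>\<^bold>k\<close>-linearity refers to the vector space structure obtained by restricting
  the \<open>\<^bold>k[\<partial>]\<close>-action to constant polynomials.
\<close>

definition conformal_product ::
    "('k::field poly \<Rightarrow> 'a \<Rightarrow> 'a) \<Rightarrow> ('a::ab_group_add \<Rightarrow> 'a \<Rightarrow> 'a poly) \<Rightarrow> bool"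
  where "conformal_product scale f \<longleftrightarrow>
    (\<forall>a. Vector_Spaces.linear (\<lambda>k. scale [:k:]) (\<lambda>k. map_poly (scale [:k:])) (f a)) \<and>
    (\<forall>b. Vector_Spaces.linear (\<lambda>k. scale [:k:]) (\<lambda>k. map_poly (scale [:k:])) (\<lambda>a. f a b)) \<and>
    (\<forall>a b. f (D scale a) b = - pCons 0 (f a b)) \<and>
    (\<forall>a b. f a (D scale b) = pCons 0 (f a b) + map_poly (D scale) (f a b))"

definition conformal_form ::
    "('k::field poly \<Rightarrow> 'a \<Rightarrow> 'a) \<Rightarrow> ('a::ab_group_add \<Rightarrow> 'a \<Rightarrow> 'k poly) \<Rightarrow> bool"
  where "conformal_form scale \<omega> \<longleftrightarrow>
    (\<forall>a. Vector_Spaces.linear (\<lambda>k. scale [:k:]) smult (\<omega> a)) \<and>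
    (\<forall>b. Vector_Spaces.linear (\<lambda>k. scale [:k:]) smult (\<lambda>a. \<omega> a b)) \<and>
    (\<forall>a b. \<omega> (D scale a) b = - [:0, 1:] * \<omega> a b) \<and>
    (\<forall>a b. \<omega> a (D scale b) = [:0, 1:] * \<omega> a b)"

definition symmetric_form :: "('a \<Rightarrow> 'a \<Rightarrow> 'k::comm_ring_1 poly) \<Rightarrow> bool"
  where "symmetric_form \<omega> \<longleftrightarrow> (\<forall>a b. \<omega> a b = \<omega> b a \<circ>\<^sub>p [:0, -1:])"

definition conformal_dual ::
    "('k::field poly \<Rightarrow> 'a \<Rightarrow> 'a) \<Rightarrow> ('a::ab_group_add \<Rightarrow> 'k poly) set"
  where "conformal_dual scale =
    {f. Vector_Spaces.linear (\<lambda>k. scale [:k:]) smult f \<and>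
        (\<forall>a. f (D scale a) = [:0, 1:] * f a)}"

text \<open>The \<open>\<^bold>k[\<partial>]\<close>-action with \<open>(\<partial>f)\<^sub>\<lambda> = -\<lambda> f\<^sub>\<lambda>\<close>; it makes sense for all functions into \<open>\<^bold>k[\<lambda>]\<close>
  and restricts to the conformal dual.\<close>

definition dual_scale :: "'k::field poly \<Rightarrow> ('a \<Rightarrow> 'k poly) \<Rightarrow> 'a \<Rightarrow> 'k poly"
  where "dual_scale p f = (\<lambda>a. (p \<circ>\<^sub>p [:0, -1:]) * f a)"

definition nondegenerate_form ::
    "('k::field poly \<Rightarrow> 'a \<Rightarrow> 'a) \<Rightarrow> ('a::ab_group_add \<Rightarrow> 'a \<Rightarrow> 'k poly) \<Rightarrow> bool"
  where "nondegenerate_form scale \<omega> \<longleftrightarrow>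
    module_hom scale dual_scale \<omega> \<and> bij_betw \<omega> UNIV (conformal_dual scale)"

text \<open>
  In the following axioms and invariance conditions, identities in one variable are
  stated in \<open>M[\<lambda>,\<mu>]\<close> via the inclusion of \<open>M[\<lambda>]\<close>.
\<close>

locale conformal_module = module scale
  for scale :: "'k::field_char_0 poly \<Rightarrow> 'a::ab_group_add \<Rightarrow> 'a" +
  assumes finitely_generated: "\<exists>S. finite S \<and> span S = UNIV"

locale lie_conformal_algebra = conformal_module scale
  for scale :: "'k::field_char_0 poly \<Rightarrow> 'a::ab_group_add \<Rightarrow> 'a" +
  fixes br :: "'a \<Rightarrow> 'a \<Rightarrow> 'a poly"
  assumes br_product: "conformal_product scale br"
    and skew: "\<kappa> a \<star>\<^bsub>br,lam\<^esub> \<kappa> b = - (\<kappa> b \<star>\<^bsub>br, - lam - del scale\<^esub> \<kappa> a)"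
    and jacobi: "\<kappa> a \<star>\<^bsub>br,lam\<^esub> (\<kappa> b \<star>\<^bsub>br,mu\<^esub> \<kappa> c) =
      (\<kappa> a \<star>\<^bsub>br,lam\<^esub> \<kappa> b) \<star>\<^bsub>br,lam + mu\<^esub> \<kappa> c + \<kappa> b \<star>\<^bsub>br,mu\<^esub> (\<kappa> a \<star>\<^bsub>br,lam\<^esub> \<kappa> c)"

locale post_lie_conformal_algebra = lie_conformal_algebra scale br
  for scale :: "'k::field_char_0 poly \<Rightarrow> 'a::ab_group_add \<Rightarrow> 'a"
    and br :: "'a \<Rightarrow> 'a \<Rightarrow> 'a poly" +
  fixes pr :: "'a \<Rightarrow> 'a \<Rightarrow> 'a poly"
  assumes pr_product: "conformal_product scale pr"
    and post_lie: "(\<kappa> a \<star>\<^bsub>pr,lam\<^esub> \<kappa> b) \<star>\<^bsub>pr,lam + mu\<^esub> \<kappa> c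
      - (\<kappa> b \<star>\<^bsub>pr,mu\<^esub> \<kappa> a) \<star>\<^bsub>pr,lam + mu\<^esub> \<kappa> c
      + (\<kappa> a \<star>\<^bsub>br,lam\<^esub> \<kappa> b) \<star>\<^bsub>pr,lam + mu\<^esub> \<kappa> c
      + \<kappa> b \<star>\<^bsub>pr,mu\<^esub> (\<kappa> a \<star>\<^bsub>pr,lam\<^esub> \<kappa> c)
      - \<kappa> a \<star>\<^bsub>pr,lam\<^esub> (\<kappa> b \<star>\<^bsub>pr,mu\<^esub> \<kappa> c) = 0"
    and derivation: "\<kappa> a \<star>\<^bsub>pr,lam\<^esub> (\<kappa> b \<star>\<^bsub>br,mu\<^esub> \<kappa> c) =
      (\<kappa> a \<star>\<^bsub>pr,lam\<^esub> \<kappa> b) \<star>\<^bsub>br,lam + mu\<^esub> \<kappa> c + \<kappa> b \<star>\<^bsub>br,mu\<^esub> (\<kappa> a \<star>\<^bsub>pr,lam\<^esub> \<kappa> c)"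

definition bracket_invariant ::
    "('a::ab_group_add \<Rightarrow> 'a \<Rightarrow> 'a poly) \<Rightarrow> ('a \<Rightarrow> 'a \<Rightarrow> 'k::field poly) \<Rightarrow> bool"
  where "bracket_invariant br \<omega> \<longleftrightarrow> (\<forall>a b c.
    (\<kappa> a \<star>\<^bsub>br,mu\<^esub> \<kappa> b) \<star>\<^bsub>\<omega>,lam\<^esub> \<kappa> c = \<kappa> a \<star>\<^bsub>\<omega>,mu\<^esub> (\<kappa> b \<star>\<^bsub>br,lam - mu\<^esub> \<kappa> c))"

definition invariant_form ::
    "('a::ab_group_add \<Rightarrow> 'a \<Rightarrow> 'a poly) \<Rightarrow> ('a \<Rightarrow> 'a \<Rightarrow> 'a poly) \<Rightarrow>
     ('a \<Rightarrow> 'a \<Rightarrow> 'k::field poly) \<Rightarrow> bool"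
  where "invariant_form br pr \<omega> \<longleftrightarrow> bracket_invariant br \<omega> \<and> (\<forall>a b c.
    (\<kappa> a \<star>\<^bsub>pr,lam\<^esub> \<kappa> b) \<star>\<^bsub>\<omega>,lam + mu\<^esub> \<kappa> c - \<kappa> a \<star>\<^bsub>\<omega>,lam\<^esub> (\<kappa> b \<star>\<^bsub>pr,mu\<^esub> \<kappa> c) =
    (\<kappa> b \<star>\<^bsub>pr,mu\<^esub> \<kappa> a) \<star>\<^bsub>\<omega>,lam + mu\<^esub> \<kappa> c - \<kappa> b \<star>\<^bsub>\<omega>,mu\<^esub> (\<kappa> a \<star>\<^bsub>pr,lam\<^esub> \<kappa> c))"

definition left_invariant_form ::
    "('a::ab_group_add \<Rightarrow> 'a \<Rightarrow> 'a poly) \<Rightarrow> ('a \<Rightarrow> 'a \<Rightarrow> 'a poly) \<Rightarrow>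
     ('a \<Rightarrow> 'a \<Rightarrow> 'k::field poly) \<Rightarrow> bool"
  where "left_invariant_form br pr \<omega> \<longleftrightarrow> bracket_invariant br \<omega> \<and> (\<forall>a b c.
    (\<kappa> a \<star>\<^bsub>pr,lam\<^esub> \<kappa> b) \<star>\<^bsub>\<omega>,lam + mu\<^esub> \<kappa> c + \<kappa> b \<star>\<^bsub>\<omega>,mu\<^esub> (\<kappa> a \<star>\<^bsub>pr,lam\<^esub> \<kappa> c) = 0)"

locale generalized_pseudo_hessian = post_lie_conformal_algebra scale br pr
  for scale :: "'k::field_char_0 poly \<Rightarrow> 'a::ab_group_add \<Rightarrow> 'a"
    and br pr :: "'a \<Rightarrow> 'a \<Rightarrow> 'a poly" +
  fixes \<omega> :: "'a \<Rightarrow> 'a \<Rightarrow> 'k poly"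
  assumes form: "conformal_form scale \<omega>"
    and nondegenerate: "nondegenerate_form scale \<omega>"
    and symmetric: "symmetric_form \<omega>"
    and invariant: "invariant_form br pr \<omega>"

definition pp_bracket ::
    "('k::field poly \<Rightarrow> 'a \<Rightarrow> 'a) \<Rightarrow> ('a::ab_group_add \<Rightarrow> 'a \<Rightarrow> 'a poly) \<Rightarrow>
     ('a \<Rightarrow> 'a \<Rightarrow> 'a poly) \<Rightarrow> ('a \<Rightarrow> 'a \<Rightarrow> 'a poly) \<Rightarrow> 'a \<Rightarrow> 'a \<Rightarrow> 'a poly poly"
  where "pp_bracket scale br lhd rhd a b =
    \<kappa> a \<star>\<^bsub>rhd,lam\<^esub> \<kappa> b + \<kappa> a \<star>\<^bsub>lhd,lam\<^esub> \<kappa> b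
    - \<kappa> b \<star>\<^bsub>rhd, - lam - del scale\<^esub> \<kappa> a - \<kappa> b \<star>\<^bsub>lhd, - lam - del scale\<^esub> \<kappa> a
    + \<kappa> a \<star>\<^bsub>br,lam\<^esub> \<kappa> b"

locale pp_post_lie_conformal_algebra = lie_conformal_algebra scale br
  for scale :: "'k::field_char_0 poly \<Rightarrow> 'a::ab_group_add \<Rightarrow> 'a"
    and br :: "'a \<Rightarrow> 'a \<Rightarrow> 'a poly" +
  fixes lhd rhd :: "'a \<Rightarrow> 'a \<Rightarrow> 'a poly"
  assumes lhd_product: "conformal_product scale lhd"
    and rhd_product: "conformal_product scale rhd"
    and pp1: "\<kappa> a \<star>\<^bsub>lhd,lam\<^esub> (\<kappa> b \<star>\<^bsub>br,mu\<^esub> \<kappa> c) =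
      (\<kappa> a \<star>\<^bsub>br,lam\<^esub> \<kappa> b) \<star>\<^bsub>lhd,lam + mu\<^esub> \<kappa> c
      - (\<kappa> a \<star>\<^bsub>br,lam\<^esub> \<kappa> c) \<star>\<^bsub>lhd, - mu - del scale\<^esub> \<kappa> b"
    and pp2: "\<kappa> a \<star>\<^bsub>br,lam\<^esub> (\<kappa> b \<star>\<^bsub>lhd,mu\<^esub> \<kappa> c + \<kappa> c \<star>\<^bsub>lhd, - mu - del scale\<^esub> \<kappa> b) =
      (\<kappa> a \<star>\<^bsub>br,lam\<^esub> \<kappa> c) \<star>\<^bsub>lhd, - mu - del scale\<^esub> \<kappa> b
      + \<kappa> b \<star>\<^bsub>lhd,mu\<^esub> (\<kappa> a \<star>\<^bsub>br,lam\<^esub> \<kappa> c)"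
    and pp3: "\<kappa> a \<star>\<^bsub>rhd,lam\<^esub> (\<kappa> b \<star>\<^bsub>br,mu\<^esub> \<kappa> c)
      - (\<kappa> b \<star>\<^bsub>br,mu\<^esub> \<kappa> c) \<star>\<^bsub>lhd, - lam - del scale\<^esub> \<kappa> a =
      (\<kappa> a \<star>\<^bsub>rhd,lam\<^esub> \<kappa> b + \<kappa> a \<star>\<^bsub>lhd,lam\<^esub> \<kappa> b) \<star>\<^bsub>br,lam + mu\<^esub> \<kappa> c
      + \<kappa> b \<star>\<^bsub>br,mu\<^esub> (\<kappa> a \<star>\<^bsub>rhd,lam\<^esub> \<kappa> c - \<kappa> c \<star>\<^bsub>lhd, - lam - del scale\<^esub> \<kappa> a)"
    and pp4: "pp_bracket scale br lhd rhd a b \<star>\<^bsub>rhd,lam + mu\<^esub> \<kappa> c =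
      \<kappa> a \<star>\<^bsub>rhd,lam\<^esub> (\<kappa> b \<star>\<^bsub>rhd,mu\<^esub> \<kappa> c) - \<kappa> b \<star>\<^bsub>rhd,mu\<^esub> (\<kappa> a \<star>\<^bsub>rhd,lam\<^esub> \<kappa> c)
      + \<kappa> b \<star>\<^bsub>br,mu\<^esub> (\<kappa> a \<star>\<^bsub>lhd,lam\<^esub> \<kappa> c) - \<kappa> a \<star>\<^bsub>br,lam\<^esub> (\<kappa> b \<star>\<^bsub>lhd,mu\<^esub> \<kappa> c)
      - (\<kappa> a \<star>\<^bsub>br,lam\<^esub> \<kappa> b) \<star>\<^bsub>lhd,lam + mu\<^esub> \<kappa> c"
    and pp5: "(\<kappa> a \<star>\<^bsub>rhd,lam\<^esub> \<kappa> b - \<kappa> b \<star>\<^bsub>lhd,mu\<^esub> \<kappa> a) \<star>\<^bsub>lhd,lam + mu\<^esub> \<kappa> c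
      + \<kappa> b \<star>\<^bsub>lhd,mu\<^esub> (\<kappa> a \<star>\<^bsub>rhd,lam\<^esub> \<kappa> c + \<kappa> a \<star>\<^bsub>lhd,lam\<^esub> \<kappa> c) =
      \<kappa> a \<star>\<^bsub>rhd,lam\<^esub> (\<kappa> b \<star>\<^bsub>lhd,mu\<^esub> \<kappa> c) + \<kappa> a \<star>\<^bsub>br,lam\<^esub> (\<kappa> b \<star>\<^bsub>lhd,mu\<^esub> \<kappa> c)"

locale special_pp_post_lie_conformal_algebra = pp_post_lie_conformal_algebra scale br lhd rhd
  for scale :: "'k::field_char_0 poly \<Rightarrow> 'a::ab_group_add \<Rightarrow> 'a"
    and br lhd rhd :: "'a \<Rightarrow> 'a \<Rightarrow> 'a poly" +
  assumes special: "\<kappa> a \<star>\<^bsub>lhd,lam\<^esub> \<kappa> b = - (\<kappa> b \<star>\<^bsub>lhd, - lam - del scale\<^esub> \<kappa> a)"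

definition lhd_equation ::
    "('a::ab_group_add \<Rightarrow> 'a \<Rightarrow> 'a poly) \<Rightarrow> ('a \<Rightarrow> 'a \<Rightarrow> 'k::field poly) \<Rightarrow>
     ('a \<Rightarrow> 'a \<Rightarrow> 'a poly) \<Rightarrow> bool"
  where "lhd_equation pr \<omega> lhd \<longleftrightarrow> (\<forall>a b c.
    (\<kappa> a \<star>\<^bsub>lhd,mu\<^esub> \<kappa> b) \<star>\<^bsub>\<omega>,lam\<^esub> \<kappa> c = \<kappa> a \<star>\<^bsub>\<omega>,mu\<^esub> (\<kappa> c \<star>\<^bsub>pr, - lam\<^esub> \<kappa> b))"

definition rhd_equation ::
    "('k::field poly \<Rightarrow> 'a \<Rightarrow> 'a) \<Rightarrow> ('a::ab_group_add \<Rightarrow> 'a \<Rightarrow> 'a poly) \<Rightarrow>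
     ('a \<Rightarrow> 'a \<Rightarrow> 'k poly) \<Rightarrow> ('a \<Rightarrow> 'a \<Rightarrow> 'a poly) \<Rightarrow> bool"
  where "rhd_equation scale pr \<omega> rhd \<longleftrightarrow> (\<forall>a b c.
    (\<kappa> a \<star>\<^bsub>rhd,mu\<^esub> \<kappa> b) \<star>\<^bsub>\<omega>,lam\<^esub> \<kappa> c =
    - (\<kappa> b \<star>\<^bsub>\<omega>,lam - mu\<^esub> (\<kappa> a \<star>\<^bsub>pr,mu\<^esub> \<kappa> c - \<kappa> c \<star>\<^bsub>pr, - mu - del scale\<^esub> \<kappa> a)))"

end

theory Submission
  imports Defs
begin

text \<open>
  Two reductions turn every identity into one between scalars. Since \<open>\<^bold>k\<close> is infinite, the
  variables \<open>\<lambda>\<close> and \<open>\<mu>\<close> may be replaced by scalars; and since the form is non-degenerate, elements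
  may be compared by pairing them with all \<open>d\<close>. Inside a pairing \<open>\<partial>\<close> acts as a scalar, so subscripts
  such as \<open>- \<mu> - \<partial>\<close> become scalars too (\<open>op_eval_shifted\<close>). What remains are ordinary identities in
  a post-Lie algebra with an invariant symmetric form, decorated with weights that add up to zero.

  Existence of the products is duality: by non-degeneracy every functional in the conformal dual
  is represented by an element, and finite generation bounds the degree in \<open>\<mu>\<close>
  (\<open>W_represents\<close>). Uniqueness is again non-degeneracy.

  The axioms rest on three facts, written here without weights. Put
  \<open>S(a, b, c) = (ab, c) + (ac, b)\<close>; invariance makes it totally symmetric. This gives
  \<open>a \<rhd> b + a \<lhd> b = ab\<close> (\<open>W_R_L\<close>). Directly from the definitions, \<open>a \<rhd> c - c \<lhd> a\<close> is minus the
  adjoint of left multiplication by \<open>a\<close>, applied to \<open>c\<close> (\<open>W_R_minus_L\<close>). Finally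
  \<open>S([x, y], z, w) = 0\<close> (\<open>Q_zero\<close>): it is symmetric in \<open>z\<close> and \<open>w\<close> but, as multiplication is a
  derivation of the bracket and the bracket is skew for the form, antisymmetric in \<open>y\<close> and \<open>w\<close>.
  Then axioms 1 and 3 are adjoint forms of the derivation property, axiom 5 is an adjoint form of
  the post-Lie identity, both sides of axiom 2 vanish, and axiom 4 is a combination of post-Lie
  identities and values of \<open>S([x, y], z, w)\<close>. The pairing of \<open>a \<lhd> b + b \<lhd> a\<close> with \<open>c\<close> is
  \<open>S(c, a, b)\<close>, which vanishes when the form is left-invariant.
\<close>

section \<open>Weighted post-Lie algebras with an invariant form\<close>

text \<open>
  The variables \<open>\<lambda>\<close>, \<open>\<mu>\<close> and the operator \<open>\<partial>\<close> are bookkeeping for weights. After evaluation at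
  scalars, \<open>B l\<close> is the bracket and \<open>P l\<close> the product with first argument of weight \<open>l\<close>, and
  \<open>W n x c\<close> is the form with \<open>x\<close> of weight \<open>n\<close> and \<open>c\<close> of weight \<open>- n\<close>. In a pairing all weights
  add up to zero, and the first argument of every product determines its index. Erasing the
  indices leaves a post-Lie algebra with a symmetric invariant form, and every identity below
  becomes one about such an algebra.
\<close>

locale weighted_post_lie =
  fixes B P :: "'k::field_char_0 \<Rightarrow> 'a::ab_group_add \<Rightarrow> 'a \<Rightarrow> 'a"
    and W :: "'k \<Rightarrow> 'a \<Rightarrow> 'a \<Rightarrow> 'k"
  assumes P_left: "additive (\<lambda>a. P l a b)" and P_right: "additive (P l a)"
    and W_left: "additive (\<lambda>a. W l a b)" and W_right: "additive (W l a)"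
    and W_sym: "W n a b = W (- n) b a"
    and B_skew: "W n (B l a b) c = - W n (B (n - l) b a) c"
    and W_B: "W n (B m a b) c = W m a (B (n - m) b c)"
    and W_P: "W (l + m) (P l a b) c - W l a (P m b c) = W (l + m) (P m b a) c - W m b (P l a c)"
    and post_lie: "P (l + m) (P l a b) c - P (l + m) (P m b a) c + P (l + m) (B l a b) c
      + P m b (P l a c) - P l a (P m b c) = 0"
    and P_B: "P l a (B m b c) = B (l + m) (P l a b) c + B m b (P l a c)"
begin

lemmas W_simps = additive.add[OF W_left] additive.add[OF W_right]
  additive.diff[OF W_left] additive.diff[OF W_right]
  additive.minus[OF W_left] additive.minus[OF W_right]

lemmas P_simps = additive.add[OF P_left] additive.add[OF P_right]
  additive.diff[OF P_left] additive.diff[OF P_right]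

lemma B_skew_right: "W l a (B q x y) = - W l a (B (- l - q) y x)"
  using W_sym B_skew by metis

text \<open>The adjoint of \<open>[a, \<cdot>]\<close> is its negative.\<close>

lemma W_B_right: "W n b (B l a c) = - W (l + n) (B l a b) c"
  using W_B[of "l + n" n b a c] B_skew[of "l + n" l a b c] by simp

text \<open>
  Without weights \<open>S\<close> is \<open>(ab, c) + (ac, b)\<close>. It is symmetric in \<open>b\<close> and \<open>c\<close> by construction, and
  the invariance of the form under the product says that it is symmetric in \<open>a\<close> and \<open>b\<close>. Thus it
  is totally symmetric.
\<close>

definition S :: "'k \<Rightarrow> 'k \<Rightarrow> 'a \<Rightarrow> 'a \<Rightarrow> 'a \<Rightarrow> 'k"
  where "S l m a b c = W (l + m) (P l a b) c + W m b (P l a c)"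

lemma S_swap12: "S l m a b c = S m l b a c"
  using W_P[of l m a b c] by (simp add: S_def algebra_simps)

lemma S_swap23: "S l m a b c = S l (- l - m) a c b"
  using W_sym[of "l + m" "P l a b" c] W_sym[of m b "P l a c"] by (simp add: S_def algebra_simps)

text \<open>
  Without weights \<open>Q\<close> is \<open>S\<close> at \<open>([x, y], z, w)\<close>. The weights of \<open>x\<close>, \<open>y\<close>, \<open>z\<close> are \<open>p\<close>, \<open>q\<close>, \<open>r\<close>, and
  that of \<open>w\<close> is \<open>- p - q - r\<close>.
\<close>

definition Q :: "'k \<Rightarrow> 'k \<Rightarrow> 'k \<Rightarrow> 'a \<Rightarrow> 'a \<Rightarrow> 'a \<Rightarrow> 'a \<Rightarrow> 'k"
  where "Q p q r x y z w = S (p + q) r (B p x y) z w"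

lemma Q_swap34: "Q p q r x y z w = Q p q (- p - q - r) x y w z"
  using S_swap23[of "p + q" r "B p x y" z w] by (simp add: Q_def algebra_simps)

text \<open>\<open>S\<close> is rotated to \<open>(z, [x, y], w)\<close>, where multiplication by \<open>z\<close> is a derivation of the bracket.\<close>

lemma Q_alt: "Q p q r x y z w = 
   W (p + q + r) (B (p + r) (P r z x) y) w + W (p + q + r) (B p x (P r z y)) w 
   + W (p + q) (B p x y) (P r z w)"
  unfolding Q_def by (subst S_swap12) (simp add: S_def P_B W_simps algebra_simps)

text \<open>Each of the three terms of the expansion changes sign because \<open>[u, \<cdot>]\<close> is skew-adjoint.\<close>

lemma Q_swap24: "Q p q r x y z w = - Q p (- p - q - r) r x w z y"
proof -
  have 1: "W (p + q + r) (B (p + r) (P r z x) y) w = - W (- q) (B (p + r) (P r z x) w) y"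
    using W_B_right[of "-p-q-r" w "p + r" "P r z x" y]
      W_sym[of "p + q + r" "B (p + r) (P r z x) y" w] by (simp add: algebra_simps)
  have 2: "W (p + q + r) (B p x (P r z y)) w = - W (- q - r) (B p x w) (P r z y)"
    using W_B_right[of "-p-q-r" w "p" x "P r z y"]
      W_sym[of "p + q + r" "B p x (P r z y)" w] by (simp add: algebra_simps)
  have 3: "W (p + q) (B p x y) (P r z w) = - W (- q) (B p x (P r z w)) y"
    using W_B_right[of "q" y p x "P r z w"] 
      W_sym[of "q" y "B p x (P r z w)"] by (simp add: algebra_simps)
  show ?thesis unfolding Q_alt using 1 2 3 by (simp add: algebra_simps)
qed

text \<open>
  \<open>Q\<close> is antisymmetric under one transposition and symmetric under another one that is conjugate
  to it, so it vanishes in characteristic zero.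
\<close>

lemma Q_zero: "Q p q r x y z w = 0"
proof -
  let ?t = "- p - q - r"
  (* The swap of y and w and the swap of z and w alternate. Their product has order three, so three
     rounds, with three changes of sign, restore the original arguments. *)
  have t: "- p - r - q = ?t" "- p - r - ?t = q" "- p - q - ?t = r" "- p - ?t - q = r" 
    "- p - ?t - r = q" "- r - p - q = ?t" "- q - p - r = ?t"
    by (simp_all add: algebra_simps)
  have "Q p q r x y z w = - Q p ?t r x w z y" by (rule Q_swap24)
  also have "\<dots> = - Q p ?t q x w y z" by (subst Q_swap34) (simp add: t)
  also have "\<dots> = Q p r q x z y w" by (subst Q_swap24) (simp add: t algebra_simps)
  also have "\<dots> = Q p r ?t x z w y" by (subst Q_swap34) (simp add: t)
  also have "\<dots> = - Q p q ?t x y w z" by (subst Q_swap24) (simp add: t algebra_simps)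
  also have "\<dots> = - Q p q r x y z w" by (subst Q_swap34) (simp add: t)
  finally show ?thesis by simp
qed

end

text \<open>
  Without weights, \<open>L\<close> and \<open>R\<close> are given by \<open>(a \<lhd> b, c) = (a, cb)\<close> and
  \<open>(a \<rhd> b, c) = (b, ca - ac)\<close>.
\<close>

locale weighted_adjoint = weighted_post_lie B P W
  for B P :: "'k::field_char_0 \<Rightarrow> 'a::ab_group_add \<Rightarrow> 'a \<Rightarrow> 'a"
    and W :: "'k \<Rightarrow> 'a \<Rightarrow> 'a \<Rightarrow> 'k" +
  fixes L R :: "'k \<Rightarrow> 'a \<Rightarrow> 'a \<Rightarrow> 'a"
  assumes W_L: "W n (L m a b) c = W m a (P (- n) c b)"
    and W_R: "W n (R m a b) c = W (n - m) b (P (- n) c a) - W (n - m) b (P m a c)"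
begin

text \<open>
  The product splits as \<open>ab = a \<rhd> b + a \<lhd> b\<close>: the two adjoints differ by the terms that total
  symmetry of \<open>S\<close> exchanges.
\<close>

lemma W_R_L: "W n (R m a b) c + W n (L m a b) c = W n (P m a b) c"
proof -
  have "W (n - m) b (P (- n) c a) + W m a (P (- n) c b) = S (-n) m c a b"
    using W_sym[of "n - m" b "P (- n) c a"] by (simp add: S_def algebra_simps)
  also have "\<dots> = S m (n - m) a b c"
    by (subst S_swap12, subst S_swap23) (simp add: algebra_simps)
  finally show ?thesis by (simp add: W_L W_R S_def algebra_simps)
qed

text \<open>The combination \<open>a \<rhd> c - c \<lhd> a\<close> is minus the adjoint of left multiplication by \<open>a\<close>.\<close>

lemma W_R_minus_L: "W n (R m a c) d - W n (L (n - m) c a) d = - W (n - m) c (P m a d)"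
  by (simp add: W_L W_R)

lemma W_L_sym: "W n (L m b c) x + W n (L (n - m) c b) x = S (- n) m x b c"
  using W_sym[of m b "P (-n) x c"] W_sym[of "n - m" c "P (-n) x b"] by (simp add: W_L S_def)

text \<open>The first axiom is the adjoint form of the derivation property of multiplication by \<open>d\<close>.\<close>

lemma pp1: "W n (L l a (B m b c)) d
  = W n (L (l + m) (B l a b) c) d - W n (L (n - m) (B l a c) b) d"
  using B_skew_right[of l a "m - n" "P (-n) d b" c]
  by (simp add: W_L P_B W_simps W_B algebra_simps)

text \<open>Both sides of the second axiom are values of \<open>Q\<close>, hence zero.\<close>

lemma pp2: "W n (B l a (L m b c)) d + W n (B l a (L (n - l - m) c b)) d
  = W n (L (n - m) (B l a c) b) d + W n (L m b (B l a c)) d"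
proof -
  have "W n (B l a y) d = - W (n - l) y (B l a d)" for y
    using W_B_right[of "n - l" y l a d] by simp
  then have "W n (B l a (L m b c)) d + W n (B l a (L (n - l - m) c b)) d
    = - S (l - n) m (B l a d) b c"
    using W_L_sym[of "n - l" m b c "B l a d"] by (simp add: algebra_simps)
  moreover have "S (l - n) m (B l a d) b c = 0"
    using Q_zero[of l "- n" m a d b c] by (simp add: Q_def)
  moreover have "W n (L (n - m) (B l a c) b) d + W n (L m b (B l a c)) d = 0"
    using W_L_sym[of n m b "B l a c" d] Q_zero[of l "n - l - m" "-n" a c d b]
      S_swap23[of "-n" m d b "B l a c"] S_swap12[of "-n" "n - m" d "B l a c" b]
    by (simp add: Q_def algebra_simps)
  ultimately show ?thesis by simp
qed

text \<open>The third axiom is the adjoint form of the derivation property of multiplication by \<open>a\<close>.\<close>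

lemma pp3: "W n (R l a (B m b c)) d - W n (L (n - l) (B m b c) a) d
  = W n (B (l + m) (P l a b) c) d + W n (B m b (R l a c)) d - W n (B m b (L (n - m - l) c a)) d"
proof -
  have "W n (B m b y) d = - W (n - m) y (B m b d)" for y
    using W_B_right[of "n - m" y m b d] by simp
  then have "W n (B m b (R l a c)) d - W n (B m b (L (n - m - l) c a)) d
    = W (n - m - l) c (P l a (B m b d))"
    using W_R_minus_L[of "n - m" l a c "B m b d"] by (simp add: algebra_simps)
  also have "\<dots> = W (n - m - l) c (B (l + m) (P l a b) d) + W (n - m - l) c (B m b (P l a d))"
    by (simp add: P_B W_simps)
  also have "\<dots> = - W n (B (l + m) (P l a b) c) d - W (n - l) (B m b c) (P l a d)"
    using W_B_right[of "n - m - l" c "l + m" "P l a b" d] W_B_right[of "n - m - l" c m b "P l a d"]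
    by (simp add: algebra_simps)
  finally show ?thesis
    by (simp only: W_R_minus_L add_diff_eq[symmetric]) simp
qed

text \<open>
  The left side is the pairing of \<open>{a, b} \<rhd> c\<close> with \<open>d\<close>, where \<open>{a, b} = ab - ba + [a, b]\<close> because
  \<open>ab = a \<rhd> b + a \<lhd> b\<close>. By three instances of the post-Lie identity all iterated products cancel;
  the terms with a bracket that remain form three values of \<open>Q\<close>.
\<close>

lemma pp4: "W (n - l - m) c (P (- n) d (P l a b)) - W (n - l - m) c (P (- n) d (P m b a))
    + W (n - l - m) c (P (- n) d (B l a b))
    - W (n - l - m) c (P (l + m) (P l a b) d) + W (n - l - m) c (P (l + m) (P m b a) d)
    - W (n - l - m) c (P (l + m) (B l a b) d)
  = W n (R l a (R m b c)) d - W n (R m b (R l a c)) d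
    + W n (B m b (L l a c)) d - W n (B l a (L m b c)) d - W n (L (l + m) (B l a b) c) d"
proof -
  let ?w = "W (n - l - m) c"
  have RR: "W n (R l a (R m b c)) d = W (n - l - m) c (P (l - n) (P (- n) d a) b)
      - W (n - l - m) c (P (l - n) (P l a d) b)
      - W (n - l - m) c (P m b (P (- n) d a)) + W (n - l - m) c (P m b (P l a d))" for l m a b
    by (simp add: W_R P_simps W_simps algebra_simps)
  have n: "n - m - l = n - l - m" by simp
  have pl: "?w (P (l + m) (P l a b) d) - ?w (P (l + m) (P m b a) d) + ?w (P (l + m) (B l a b) d)
      = ?w (P l a (P m b d)) - ?w (P m b (P l a d))"
    using arg_cong[OF post_lie[of l m a b d], of ?w]
    by (simp add: W_simps additive.zero[OF W_right] algebra_simps)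
  have pl': "?w (P (l - n) (P (- n) d a) b) - ?w (P (l - n) (P l a d) b)
      = ?w (P (- n) d (P l a b)) - ?w (P l a (P (- n) d b)) + ?w (P (l - n) (B l a d) b)" for l a b
    using arg_cong[OF post_lie[of l "- n" a d b], of ?w]
    by (simp add: W_simps additive.zero[OF W_right] algebra_simps)
  have S: "W (n - l - m) c (P (l - n) (B l a d) b) + W m b (P (l - n) (B l a d) c) = 0"
    for l m a b
    using Q_zero[of l "- n" m a d b c] W_sym[of "l - n + m" "P (l - n) (B l a d) b" c]
    by (simp add: Q_def S_def algebra_simps)
  have S': "?w (P (- n) d (B l a b)) + W (l + m) (B l a b) (P (- n) d c) = 0"
  proof -
    have "S (- n) (l + m) d (B l a b) c = 0"
      by (metis Q_def Q_zero S_swap12)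
    then show ?thesis
      using W_sym[of "l + m - n" "P (- n) d (B l a b)" c] by (simp add: S_def algebra_simps)
  qed
  have BL: "W n (B l a (L m b c)) d = - W m b (P (l - n) (B l a d) c)" for l m a b
    using W_B_right[of "n - l" "L m b c" l a d] by (simp add: W_L)
  show ?thesis
    unfolding BL W_L[of n "l + m"] RR[of l a m b] RR[of m b l a]
    using pl pl'[of l a b] pl'[of m b a] S[of l m a b] S[of m l b a] S'
    unfolding n by algebra
qed

text \<open>
  By the formula for the adjoint of left multiplication, both sides are pairings with \<open>b\<close>. They
  agree by the post-Lie identity for \<open>a\<close>, \<open>d\<close>, \<open>c\<close>.
\<close>

lemma pp5: "W n (L (l + m) (R l a b) c) d - W n (L (l + m) (L m b a) c) d + W n (L m b (P l a c)) d
  = W n (R l a (L m b c)) d + W n (B l a (L m b c)) d"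
proof -
  have 1: "W n (L (l + m) (R l a b) c) d - W n (L (l + m) (L m b a) c) d + W n (L m b (P l a c)) d
    = W m b (P (-n) d (P l a c)) - W m b (P l a (P (-n) d c))"
    using W_R_minus_L[of "l + m" l a b "P (-n) d c"] by (simp add: W_L)
  have 2: "W n (B l a (L m b c)) d = - W m b (P (l - n) (B l a d) c)"
    using W_B_right[of "n - l" "L m b c" l a d] by (simp add: W_L)
  have 3: "W n (R l a (L m b c)) d = W m b (P (l - n) (P (-n) d a) c) - W m b (P (l - n) (P l a d) c)"
    by (simp add: W_R W_L)
  show ?thesis unfolding 1 2 3 using arg_cong[OF post_lie[of l "-n" a d c], of "W m b"]
    by (simp add: W_simps additive.zero[OF W_right] algebra_simps)
qed

end

section \<open>Evaluation of polynomials with module coefficients\<close>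

lemma additive_funpow: "additive \<tau> \<Longrightarrow> additive (\<tau> ^^ n)"
  for \<tau> :: "'m::ab_group_add \<Rightarrow> 'm"
  by (induction n) (auto simp: additive_def)

lemma additive_map_poly: "additive g \<Longrightarrow> additive (map_poly g)"
  for g :: "'m::ab_group_add \<Rightarrow> 'n::ab_group_add"
  by (auto simp: additive_def poly_eq_iff coeff_map_poly additive.zero)

text \<open>The value of a polynomial with coefficients in a module at an endomorphism.\<close>

definition op_eval :: "('m::ab_group_add \<Rightarrow> 'm) \<Rightarrow> 'm poly \<Rightarrow> 'm"
  where "op_eval \<tau> p = (\<Sum>n\<le>degree p. (\<tau> ^^ n) (coeff p n))"

lemma op_eval_bound:
  assumes "additive \<tau>" "degree p \<le> N"
  shows "op_eval \<tau> p = (\<Sum>n\<le>N. (\<tau> ^^ n) (coeff p n))"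
  unfolding op_eval_def
  by (rule sum.mono_neutral_left)
    (use assms in \<open>auto simp: additive.zero[OF additive_funpow] not_le coeff_eq_0\<close>)

lemma additive_op_eval:
  assumes "additive \<tau>"
  shows "additive (op_eval \<tau>)"
proof
  fix p q :: "'a poly"
  let ?N = "max (degree p) (degree q)"
  show "op_eval \<tau> (p + q) = op_eval \<tau> p + op_eval \<tau> q"
    by (simp add: op_eval_bound[OF assms, of _ ?N] degree_add_le
        additive.add[OF additive_funpow[OF assms]] sum.distrib)
qed

lemma op_eval_0: "additive \<tau> \<Longrightarrow> op_eval \<tau> 0 = 0"
  by (simp add: additive.zero additive_op_eval)

lemma op_eval_pCons:
  assumes "additive \<tau>"
  shows "op_eval \<tau> (pCons a p) = a + \<tau> (op_eval \<tau> p)"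
proof -
  have "op_eval \<tau> (pCons a p) = (\<Sum>n\<le>Suc (degree p). (\<tau> ^^ n) (coeff (pCons a p) n))"
    by (rule op_eval_bound[OF assms degree_pCons_le])
  also have "\<dots> = a + (\<Sum>n\<le>degree p. \<tau> ((\<tau> ^^ n) (coeff p n)))"
    by (simp add: sum.atMost_Suc_shift del: sum.atMost_Suc)
  finally show ?thesis by (simp add: op_eval_def additive.sum[OF assms])
qed

text \<open>
  All exchanges of evaluation with \<open>\<partial>\<close>, scalars and linear functionals are instances of this
  naturality.
\<close>

lemma op_eval_natural:
  assumes \<tau>: "additive \<tau>" and g: "additive g" and \<tau>': "additive \<tau>'"
    and comm: "\<And>x. g (\<tau> x) = \<tau>' (g x)"
  shows "g (op_eval \<tau> p) = op_eval \<tau>' (map_poly g p)"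
  by (induction p)
    (auto simp: op_eval_0 op_eval_pCons assms additive.zero additive.add map_poly_pCons)

lemma op_eval_mult: "op_eval ((*) x) p = poly p x"
  for x :: "'k::comm_ring_1"
proof -
  have "additive ((*) x)" by (simp add: additive_def distrib_left)
  then show ?thesis by (induction p) (simp_all add: op_eval_0 op_eval_pCons)
qed

text \<open>The inner variable \<open>\<lambda>\<close> takes the value \<open>l\<close>, the outer variable \<open>\<mu>\<close> the value \<open>m\<close>.\<close>

definition eval2 :: "('k \<Rightarrow> 'm::ab_group_add \<Rightarrow> 'm) \<Rightarrow> 'k \<Rightarrow> 'k \<Rightarrow> 'm poly poly \<Rightarrow> 'm"
  where "eval2 s l m P = op_eval (s m) (map_poly (op_eval (s l)) P)"

context vector_space
begin

lemma additive_scale: "additive (scale k)"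
  by (simp add: additive_def scale_right_distrib)

lemmas additive_eval = additive_op_eval[OF additive_scale]

lemma additive_eval2: "additive (eval2 scale l m)"
  using additive_eval additive_map_poly[OF additive_eval]
  unfolding additive_def eval2_def by metis

lemma eval2_const: "eval2 scale l m (\<kappa> a) = a"
  by (simp add: eval2_def map_poly_pCons op_eval_pCons additive_scale op_eval_0
      additive.zero[OF additive_eval])

lemma eval2_mu: "eval2 scale l m (mu X) = scale m (eval2 scale l m X)"
  by (simp add: eval2_def mu_def map_poly_pCons additive.zero[OF additive_eval] op_eval_0
      op_eval_pCons additive_scale)

lemma eval2_map:
  assumes "additive T" "additive g" "\<And>x. op_eval (scale l) (T x) = g (op_eval (scale l) x)"
    "\<And>k x. g (scale k x) = scale k (g x)"
  shows "eval2 scale l m (map_poly T X) = g (eval2 scale l m X)"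
proof -
  have "map_poly (op_eval (scale l)) (map_poly T X) = map_poly g (map_poly (op_eval (scale l)) X)"
    using assms(3)
    by (simp add: poly_eq_iff coeff_map_poly additive.zero[OF assms(1)] additive.zero[OF assms(2)]
        additive.zero[OF additive_eval])
  moreover have "g (op_eval (scale m) p) = op_eval (scale m) (map_poly g p)" for p
    by (rule op_eval_natural) (fact additive_scale assms(2) additive_scale assms(4))+
  ultimately show ?thesis
    by (simp only: eval2_def)
qed

lemma eval2_lam: "eval2 scale l m (lam X) = scale l (eval2 scale l m X)"
  unfolding lam_def
  by (rule eval2_map[where g = "scale l"])
    (simp_all add: additive_scale op_eval_pCons mult.commute, simp add: additive_def)

lemma eval2_coeffwise:
  assumes "additive g" "\<And>k x. g (scale k x) = scale k (g x)"
  shows "eval2 scale l m (map_poly (map_poly g) X) = g (eval2 scale l m X)"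
proof (rule eval2_map[where g = g])
  show "op_eval (scale l) (map_poly g x) = g (op_eval (scale l) x)" for x
    by (rule op_eval_natural[symmetric]) (fact additive_scale assms)+
qed (fact additive_map_poly assms additive_map_poly[OF assms(1)])+

lemma funpow_scale: "(scale k ^^ n) x = scale (k ^ n) x"
  by (induction n) (simp_all)

text \<open>If the subscript \<open>T\<close> becomes the operator \<open>\<tau>\<close> under evaluation, then substituting \<open>T\<close> becomes
  substituting \<open>\<tau>\<close>. For \<open>T = - \<lambda> - \<partial>\<close> the operator \<open>\<tau>\<close> is \<open>- l - \<partial>\<close>, so it is not a scalar in general.\<close>

lemma eval2_subst_op:
  assumes T: "\<And>X. eval2 scale l m (T X) = \<tau> (eval2 scale l m X)"
  shows "eval2 scale l m (subst_op T p) = op_eval \<tau> p"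
proof -
  have "eval2 scale l m ((T ^^ n) X) = (\<tau> ^^ n) (eval2 scale l m X)" for n X
    by (induction n) (simp_all add: T)
  then show ?thesis
    by (simp add: subst_op_def op_eval_def additive.sum[OF additive_eval2] eval2_const)
qed

lemma eval2_sum: "eval2 scale l m P =
  (\<Sum>j\<le>degree P. \<Sum>i\<le>degree (coeff P j). scale (l ^ i) (scale (m ^ j) (coeff (coeff P j) i)))"
proof -
  have "eval2 scale l m P = (\<Sum>j\<le>degree P. scale (m ^ j) (op_eval (scale l) (coeff P j)))"
    by (simp add: eval2_def op_eval_bound[OF additive_scale map_poly_degree_leq] coeff_map_poly
        op_eval_0 additive_scale funpow_scale)
  then show ?thesis
    by (simp add: op_eval_def funpow_scale scale_sum_right mult.commute)
qed

end

text \<open>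
  Evaluation turns the product of two polynomials, with \<open>T\<close> acting on the coefficients of the
  product only, into the product of their values. Bilinearity of \<open>f\<close> makes this possible: \<open>\<lambda>\<close> and
  \<open>\<mu>\<close> from either factor can be moved out of \<open>f\<close> and past \<open>\<tau>\<close>.
\<close>

lemma eval2_ext:
  fixes f :: "'a::ab_group_add \<Rightarrow> 'a \<Rightarrow> 'm::ab_group_add poly"
  assumes s: "vector_space s" and s': "vector_space s'"
    and T: "\<And>X. eval2 s' l m (T X) = \<tau> (eval2 s' l m X)"
    and \<tau>: "additive \<tau>" "\<And>k x. \<tau> (s' k x) = s' k (\<tau> x)"
    and f_left: "\<And>y. additive (\<lambda>x. f x y)" and f_right: "\<And>x. additive (f x)"
    and f_s_left: "\<And>k x y. f (s k x) y = map_poly (s' k) (f x y)"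
    and f_s_right: "\<And>k x y. f x (s k y) = map_poly (s' k) (f x y)"
  shows "eval2 s' l m (P \<star>\<^bsub>f,T\<^esub> Q) = op_eval \<tau> (f (eval2 s l m P) (eval2 s l m Q))"
proof -
  interpret s: vector_space s by fact
  interpret s': vector_space s' by fact
  define F where "F x y = op_eval \<tau> (f x y)" for x y
  have F_left: "additive (\<lambda>x. F x y)" and F_right: "additive (F x)" for x y
    using f_left f_right additive_op_eval[OF \<tau>(1)] by (simp_all add: F_def additive_def)
  have sF: "s' k (op_eval \<tau> p) = op_eval \<tau> (map_poly (s' k) p)" for k p
    by (rule op_eval_natural) (simp_all add: \<tau> s'.additive_scale)
  have F_s_left: "F (s k x) y = s' k (F x y)" and F_s_right: "F x (s k y) = s' k (F x y)" for k x y
    by (simp_all add: F_def f_s_left f_s_right sF)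
  have lam: "eval2 s' l m ((lam ^^ n) X) = s' (l ^ n) (eval2 s' l m X)" for n X
    by (induction n) (simp_all add: s'.eval2_lam)
  have mu: "eval2 s' l m ((mu ^^ n) X) = s' (m ^ n) (eval2 s' l m X)" for n X
    by (induction n) (simp_all add: s'.eval2_mu)
  have "eval2 s' l m (P \<star>\<^bsub>f,T\<^esub> Q) = (\<Sum>j\<le>degree P. \<Sum>i\<le>degree (coeff P j).
      \<Sum>h\<le>degree Q. \<Sum>k\<le>degree (coeff Q h).
      s' (l ^ (i + k)) (s' (m ^ (j + h)) (F (coeff (coeff P j) i) (coeff (coeff Q h) k))))"
    by (simp add: ext_def additive.sum[OF s'.additive_eval2] lam mu s'.eval2_subst_op[where T = T and \<tau> = \<tau>, OF T] F_def)
  also have "\<dots> = F (eval2 s l m P) (eval2 s l m Q)"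
    (* The first argument is expanded before the second, to match the order of the sums. *)
    unfolding s.eval2_sum additive.sum[OF F_left] unfolding additive.sum[OF F_right]
    by (simp only: F_s_left F_s_right power_add s'.scale_scale mult_ac)
  finally show ?thesis by (simp add: F_def)
qed

lemma ext_const: "\<kappa> a \<star>\<^bsub>f,T\<^esub> \<kappa> b = subst_op T (f a b)"
  by (simp add: ext_def)

text \<open>A field of characteristic zero is infinite, so polynomials are determined by their values.\<close>

lemma poly_poly_eq_iff_eval2:
  fixes p q :: "'k::field_char_0 poly poly"
  shows "p = q \<longleftrightarrow> (\<forall>l m. eval2 (*) l m p = eval2 (*) l m q)"
proof
  assume eq: "\<forall>l m. eval2 (*) l m p = eval2 (*) l m q"
  have op: "op_eval ((*) x) = (\<lambda>p. poly p x)" for x :: 'k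
    by (simp add: op_eval_mult fun_eq_iff)
  have "poly (map_poly (\<lambda>p. poly p l) p) m = poly (map_poly (\<lambda>p. poly p l) q) m" for l m
    using eq by (simp add: eval2_def op)
  then have "map_poly (\<lambda>p. poly p l) p = map_poly (\<lambda>p. poly p l) q" for l
    by (intro iffD1[OF poly_eq_poly_eq_iff] ext)
  then have "poly (coeff p n) l = poly (coeff q n) l" for n l
    by (metis coeff_map_poly poly_0)
  then show "p = q"
    by (intro poly_eqI[of p q] iffD1[OF poly_eq_poly_eq_iff] ext)
qed simp

lemma smult_conv_map_poly_fun: "smult k = map_poly ((*) k)"
  by (simp add: fun_eq_iff poly_eq_iff coeff_map_poly)

section \<open>Evaluation and pairing in a generalized pseudo-Hessian algebra\<close>

context generalized_pseudo_hessian
begin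

abbreviation s :: "'k \<Rightarrow> 'a \<Rightarrow> 'a" where "s k \<equiv> scale [:k:]"

definition W :: "'k \<Rightarrow> 'a \<Rightarrow> 'a \<Rightarrow> 'k" where "W n a b = poly (\<omega> a b) n"

definition prod_at :: "('a \<Rightarrow> 'a \<Rightarrow> 'a poly) \<Rightarrow> 'k \<Rightarrow> 'a \<Rightarrow> 'a \<Rightarrow> 'a"
  where "prod_at f t a b = op_eval (s t) (f a b)"

text \<open>The operator \<open>- l - \<partial>\<close>, the value of the subscripts \<open>- \<lambda> - \<partial>\<close> and \<open>- \<mu> - \<partial>\<close>.\<close>

abbreviation shifted :: "'k \<Rightarrow> 'a \<Rightarrow> 'a" where "shifted l x \<equiv> - s l x - D scale x"

sublocale vs: vector_space s
  using br_product by (auto simp: conformal_product_def Vector_Spaces.linear_iff)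

sublocale kvs: vector_space "(*) :: 'k \<Rightarrow> 'k \<Rightarrow> 'k"
  by unfold_locales (simp_all add: algebra_simps)

lemma additive_D: "additive (D scale)"
  by (simp add: additive_def D_def scale_right_distrib)

lemma D_s: "D scale (s k x) = s k (D scale x)"
  by (simp add: D_def mult.commute)

lemma additive_shifted: "additive (shifted l)"
  by (simp add: additive_def additive.add[OF additive_D] vs.scale_right_distrib)

lemma shifted_s: "shifted l (s k x) = s k (shifted l x)"
  by (simp add: D_s vs.scale_right_diff_distrib mult.commute)

lemma eval2_del: "eval2 s l m (del scale X) = D scale (eval2 s l m X)"
  unfolding del_def by (rule vs.eval2_coeffwise[OF additive_D D_s])

lemma product_linear:
  assumes "conformal_product scale f"
  shows "additive (\<lambda>a. f a b)" "additive (f a)"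
    "f (s k a) b = map_poly (s k) (f a b)" "f a (s k b) = map_poly (s k) (f a b)"
    "f (D scale a) b = - pCons 0 (f a b)"
    "f a (D scale b) = pCons 0 (f a b) + map_poly (D scale) (f a b)"
  using assms by (auto simp: conformal_product_def Vector_Spaces.linear_iff additive_def)

lemma form_linear: "additive (\<lambda>a. \<omega> a b)" "additive (\<omega> a)"
    "\<omega> (s k a) b = smult k (\<omega> a b)" "\<omega> a (s k b) = smult k (\<omega> a b)"
    "\<omega> (D scale a) b = - [:0, 1:] * \<omega> a b" "\<omega> a (D scale b) = [:0, 1:] * \<omega> a b"
  using form by (auto simp: conformal_form_def Vector_Spaces.linear_iff additive_def)

lemma W_left: "additive (\<lambda>a. W n a b)" and W_right: "additive (W n a)"
  and W_s_left: "W n (s k a) b = k * W n a b" and W_s_right: "W n a (s k b) = k * W n a b"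
  and W_D_left: "W n (D scale a) b = - n * W n a b" and W_D_right: "W n a (D scale b) = n * W n a b"
  using form_linear by (auto simp: W_def additive_def)

lemma W_sym: "W n a b = W (- n) b a"
proof -
  have "\<omega> a b = \<omega> b a \<circ>\<^sub>p [:0, -1:]"
    using symmetric unfolding symmetric_form_def by blast
  then show ?thesis by (simp add: W_def poly_pcompose)
qed

lemma prod_at_left: "conformal_product scale f \<Longrightarrow> additive (\<lambda>a. prod_at f t a b)"
  and prod_at_right: "conformal_product scale f \<Longrightarrow> additive (prod_at f t a)"
  using vs.additive_eval[of t] by (simp_all add: prod_at_def additive_def product_linear(1,2)[unfolded additive_def])

lemma s_op_eval: "s k (op_eval (s t) p) = op_eval (s t) (map_poly (s k) p)"
  by (rule op_eval_natural) (simp_all add: vs.additive_scale mult.commute)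

lemma D_op_eval: "D scale (op_eval (s t) p) = op_eval (s t) (map_poly (D scale) p)"
  by (rule op_eval_natural) (simp_all add: vs.additive_scale additive_D D_s)

lemma prod_at_s_left: "conformal_product scale f \<Longrightarrow> prod_at f t (s k a) b = s k (prod_at f t a b)"
  and prod_at_s_right: "conformal_product scale f \<Longrightarrow> prod_at f t a (s k b) = s k (prod_at f t a b)"
  and prod_at_D_left: "conformal_product scale f \<Longrightarrow> prod_at f t (D scale a) b = - s t (prod_at f t a b)"
  and prod_at_D_right: "conformal_product scale f \<Longrightarrow> prod_at f t a (D scale b) = s t (prod_at f t a b) + D scale (prod_at f t a b)"
  by (simp_all add: prod_at_def product_linear s_op_eval D_op_eval additive.add[OF vs.additive_eval]
     additive.minus[OF vs.additive_eval] op_eval_pCons vs.additive_scale)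

lemma eval2_product:
  assumes f: "conformal_product scale f"
  shows "eval2 s l m (X \<star>\<^bsub>f,lam\<^esub> Y) = prod_at f l (eval2 s l m X) (eval2 s l m Y)"
    "eval2 s l m (X \<star>\<^bsub>f,mu\<^esub> Y) = prod_at f m (eval2 s l m X) (eval2 s l m Y)"
    "eval2 s l m (X \<star>\<^bsub>f,lam + mu\<^esub> Y) = prod_at f (l + m) (eval2 s l m X) (eval2 s l m Y)"
    "eval2 s l m (X \<star>\<^bsub>f,lam - mu\<^esub> Y) = prod_at f (l - m) (eval2 s l m X) (eval2 s l m Y)"
    "eval2 s l m (X \<star>\<^bsub>f,- lam\<^esub> Y) = prod_at f (- l) (eval2 s l m X) (eval2 s l m Y)"
    "eval2 s l m (X \<star>\<^bsub>f,- lam - del scale\<^esub> Y)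
      = op_eval (shifted l) (f (eval2 s l m X) (eval2 s l m Y))"
    "eval2 s l m (X \<star>\<^bsub>f,- mu - del scale\<^esub> Y)
      = op_eval (shifted m) (f (eval2 s l m X) (eval2 s l m Y))"
proof -
  have ext: "eval2 s l m (X \<star>\<^bsub>f,T\<^esub> Y) = op_eval \<tau> (f (eval2 s l m X) (eval2 s l m Y))"
    if "\<And>X. eval2 s l m (T X) = \<tau> (eval2 s l m X)" "additive \<tau>" "\<And>k x. \<tau> (s k x) = s k (\<tau> x)"
    for T \<tau>
    by (rule eval2_ext[where s = s and s' = s and f = f and T = T and \<tau> = \<tau>])
      (fact that vs.vector_space_axioms product_linear[OF f])+
  have s: "eval2 s l m (X \<star>\<^bsub>f,T\<^esub> Y) = prod_at f t (eval2 s l m X) (eval2 s l m Y)"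
    if "\<And>X. eval2 s l m (T X) = s t (eval2 s l m X)" for T t
    unfolding prod_at_def
    by (rule ext[where \<tau> = "s t"]) (simp_all add: that vs.additive_scale mult.commute)
  show "eval2 s l m (X \<star>\<^bsub>f,lam\<^esub> Y) = prod_at f l (eval2 s l m X) (eval2 s l m Y)"
    by (rule s) (rule vs.eval2_lam)
  show "eval2 s l m (X \<star>\<^bsub>f,mu\<^esub> Y) = prod_at f m (eval2 s l m X) (eval2 s l m Y)"
    by (rule s) (rule vs.eval2_mu)
  note eval2_simps = vs.eval2_lam vs.eval2_mu eval2_del additive.add[OF vs.additive_eval2]
     additive.minus[OF vs.additive_eval2] additive.diff[OF vs.additive_eval2]
  show "eval2 s l m (X \<star>\<^bsub>f,lam + mu\<^esub> Y) = prod_at f (l + m) (eval2 s l m X) (eval2 s l m Y)"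
    by (rule s) (simp add: eval2_simps vs.scale_left_distrib del: add_pCons)
  show "eval2 s l m (X \<star>\<^bsub>f,lam - mu\<^esub> Y) = prod_at f (l - m) (eval2 s l m X) (eval2 s l m Y)"
    by (rule s) (simp add: eval2_simps vs.scale_left_diff_distrib del: diff_pCons)
  show "eval2 s l m (X \<star>\<^bsub>f,- lam\<^esub> Y) = prod_at f (- l) (eval2 s l m X) (eval2 s l m Y)"
    by (rule s) (simp add: eval2_simps vs.scale_minus_left del: minus_pCons)
  show "eval2 s l m (X \<star>\<^bsub>f,- lam - del scale\<^esub> Y)
      = op_eval (shifted l) (f (eval2 s l m X) (eval2 s l m Y))"
    by (rule ext) (simp_all only: additive_shifted shifted_s minus_apply fun_diff_def uminus_apply eval2_simps)
  show "eval2 s l m (X \<star>\<^bsub>f,- mu - del scale\<^esub> Y)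
      = op_eval (shifted m) (f (eval2 s l m X) (eval2 s l m Y))"
    by (rule ext) (simp_all only: additive_shifted shifted_s minus_apply fun_diff_def uminus_apply eval2_simps)
qed

lemma eval2_form:
  shows "eval2 (*) l m (X \<star>\<^bsub>\<omega>,lam\<^esub> Y) = W l (eval2 s l m X) (eval2 s l m Y)"
    "eval2 (*) l m (X \<star>\<^bsub>\<omega>,mu\<^esub> Y) = W m (eval2 s l m X) (eval2 s l m Y)"
    "eval2 (*) l m (X \<star>\<^bsub>\<omega>,lam + mu\<^esub> Y) = W (l + m) (eval2 s l m X) (eval2 s l m Y)"
    "eval2 (*) l m (X \<star>\<^bsub>\<omega>,lam - mu\<^esub> Y) = W (l - m) (eval2 s l m X) (eval2 s l m Y)"
proof -
  have s: "eval2 (*) l m (X \<star>\<^bsub>\<omega>,T\<^esub> Y) = W t (eval2 s l m X) (eval2 s l m Y)"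
    if "\<And>X. eval2 (*) l m (T X) = t * (eval2 (*) l m X)" for T t
    unfolding W_def op_eval_mult[symmetric]
    by (rule eval2_ext[where s = s and s' = "(*)" and f = \<omega> and T = T and \<tau> = "(*) t"])
      (simp_all add: that vs.vector_space_axioms kvs.vector_space_axioms kvs.additive_scale
        form_linear smult_conv_map_poly_fun)
  note eval2_simps = kvs.eval2_lam kvs.eval2_mu additive.add[OF kvs.additive_eval2]
     additive.diff[OF kvs.additive_eval2] algebra_simps
  show "eval2 (*) l m (X \<star>\<^bsub>\<omega>,lam\<^esub> Y) = W l (eval2 s l m X) (eval2 s l m Y)"
    by (rule s) (simp add: eval2_simps)
  show "eval2 (*) l m (X \<star>\<^bsub>\<omega>,mu\<^esub> Y) = W m (eval2 s l m X) (eval2 s l m Y)"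
    by (rule s) (simp add: eval2_simps)
  show "eval2 (*) l m (X \<star>\<^bsub>\<omega>,lam + mu\<^esub> Y) = W (l + m) (eval2 s l m X) (eval2 s l m Y)"
    by (rule s) (simp add: eval2_simps)
  show "eval2 (*) l m (X \<star>\<^bsub>\<omega>,lam - mu\<^esub> Y) = W (l - m) (eval2 s l m X) (eval2 s l m Y)"
    by (rule s) (simp add: eval2_simps)
qed

text \<open>
  For constant arguments no linearity of \<open>f\<close> is involved. Hence the equations that define \<open>\<lhd>\<close> and
  \<open>\<rhd>\<close> can be evaluated while the products are still arbitrary functions.
\<close>

lemma eval2_const_product:
  "eval2 s l m (\<kappa> a \<star>\<^bsub>f,mu\<^esub> \<kappa> b) = prod_at f m a b"
  by (simp add: ext_const prod_at_def vs.eval2_subst_op[where \<tau> = "s m", OF vs.eval2_mu])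

lemmas eval2_add = additive.add[OF vs.additive_eval2] additive.add[OF kvs.additive_eval2]
  additive.minus[OF vs.additive_eval2] additive.minus[OF kvs.additive_eval2]
  additive.diff[OF vs.additive_eval2] additive.diff[OF kvs.additive_eval2]

text \<open>
  A functional on which \<open>\<partial>\<close> acts as the scalar \<open>t\<close> sees the operator \<open>- l - \<partial>\<close> as the scalar
  \<open>- l - t\<close>. Pairing with the form is such a functional in each argument, by conformal
  sesquilinearity, so every subscript that contains \<open>\<partial>\<close> becomes a weight.
\<close>

lemma op_eval_shifted:
  assumes h: "additive h" "\<And>k x. h (s k x) = k * h x" "\<And>x. h (D scale x) = t * h x"
  shows "h (op_eval (shifted l) p) = h (op_eval (s (- l - t)) p)"
proof -
  have "h (op_eval (shifted l) p) = op_eval ((*) (- l - t)) (map_poly h p)"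
    by (rule op_eval_natural[OF additive_shifted h(1) kvs.additive_scale])
      (simp add: additive.diff[OF h(1)] additive.minus[OF h(1)] h(2,3) algebra_simps)
  also have "\<dots> = h (op_eval (s (- l - t)) p)"
    by (rule op_eval_natural[symmetric, OF vs.additive_scale h(1) kvs.additive_scale]) (rule h(2))
  finally show ?thesis .
qed

lemma W_shifted: "W n (op_eval (shifted l) p) c = W n (op_eval (s (n - l)) p) c"
  using op_eval_shifted[of "\<lambda>x. W n x c" "- n" l p]
  by (simp add: W_left W_s_left W_D_left)

lemma W_eqI: "x = y" if "\<And>n c. W n x c = W n y c"
proof -
  have "\<omega> x c = \<omega> y c" for c
    using that by (intro iffD1[OF poly_eq_poly_eq_iff] ext) (simp add: W_def)
  then have "\<omega> x = \<omega> y" by blast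
  moreover have "inj \<omega>" using nondegenerate by (simp add: nondegenerate_form_def bij_betw_def)
  ultimately show ?thesis by (simp add: inj_eq)
qed

sublocale wpl: weighted_post_lie "prod_at br" "prod_at pr" W
proof
  note br = br_product and pr = pr_product
  fix l m n :: 'k and a b c x y :: 'a
  show "prod_at pr l (x + y) b = prod_at pr l x b + prod_at pr l y b" "prod_at pr l a (x + y) = prod_at pr l a x + prod_at pr l a y"
    by (simp_all add: additive.add[OF prod_at_left[OF pr]] additive.add[OF prod_at_right[OF pr]])
  show "W l (x + y) b = W l x b + W l y b" "W l a (x + y) = W l a x + W l a y"
    by (simp_all add: additive.add[OF W_left] additive.add[OF W_right])
  show "W n a b = W (- n) b a" by (rule W_sym)
  show "W n (prod_at br l a b) c = - W n (prod_at br (n - l) b a) c"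
    using arg_cong[OF skew[of a b], of "\<lambda>x. W n (eval2 s l 0 x) c"]
    by (simp add: eval2_product[OF br] eval2_add vs.eval2_const additive.minus[OF W_left] W_shifted prod_at_def)
  show "W n (prod_at br m a b) c = W m a (prod_at br (n - m) b c)"
    using arg_cong[OF invariant[unfolded invariant_form_def bracket_invariant_def,
          THEN conjunct1, rule_format, of a b c], of "eval2 (*) n m"]
    by (simp add: eval2_product[OF br] eval2_add vs.eval2_const eval2_form)
  show "W (l + m) (prod_at pr l a b) c - W l a (prod_at pr m b c) = W (l + m) (prod_at pr m b a) c - W m b (prod_at pr l a c)"
    using arg_cong[OF invariant[unfolded invariant_form_def,
          THEN conjunct2, rule_format, of a b c], of "eval2 (*) l m"]
    by (simp add: eval2_product[OF pr] eval2_add vs.eval2_const eval2_form)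
  show "prod_at pr (l + m) (prod_at pr l a b) c - prod_at pr (l + m) (prod_at pr m b a) c + prod_at pr (l + m) (prod_at br l a b) c +
       prod_at pr m b (prod_at pr l a c) - prod_at pr l a (prod_at pr m b c) = 0"
    using arg_cong[OF post_lie[of a b c], of "eval2 s l m"]
    by (simp add: eval2_product[OF pr] eval2_product[OF br] eval2_add vs.eval2_const
       additive.zero[OF vs.additive_eval2])
  show "prod_at pr l a (prod_at br m b c) = prod_at br (l + m) (prod_at pr l a b) c + prod_at br m b (prod_at pr l a c)"
    using arg_cong[OF derivation[of a b c], of "eval2 s l m"]
    by (simp add: eval2_product[OF pr] eval2_product[OF br] eval2_add vs.eval2_const)
qed

lemma W_op_eval: "W n (op_eval (s m) p) c = poly (map_poly (\<lambda>x. W n x c) p) m"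
proof -
  have "W n (op_eval (s m) p) c = op_eval ((*) m) (map_poly (\<lambda>x. W n x c) p)"
    by (rule op_eval_natural[where g = "\<lambda>x. W n x c"])
      (simp_all add: vs.additive_scale kvs.additive_scale W_left W_s_left)
  then show ?thesis by (simp add: op_eval_mult)
qed

lemma poly_eqI_W: "p = q" if "\<And>m n c. W n (op_eval (s m) p) c = W n (op_eval (s m) q) c"
proof (rule poly_eqI)
  fix i
  have "map_poly (\<lambda>x. W n x c) p = map_poly (\<lambda>x. W n x c) q" for n c
    using that unfolding W_op_eval by (intro iffD1[OF poly_eq_poly_eq_iff] ext) simp
  then have "coeff (map_poly (\<lambda>x. W n x c) p) i = coeff (map_poly (\<lambda>x. W n x c) q) i" for n c
    by simp
  then show "coeff p i = coeff q i"
    by (intro W_eqI) (simp add: coeff_map_poly additive.zero[OF W_left])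
qed

lemma poly_poly_eqI_W:
  "X = Y" if "\<And>l m n c. W n (eval2 s l m X) c = W n (eval2 s l m Y) c"
proof -
  have "map_poly (op_eval (s l)) X = map_poly (op_eval (s l)) Y" for l
    by (rule poly_eqI_W) (rule that[unfolded eval2_def])
  then have "coeff (map_poly (op_eval (s l)) X) j = coeff (map_poly (op_eval (s l)) Y) j" for l j
    by simp
  then have "op_eval (s l) (coeff X j) = op_eval (s l) (coeff Y j)" for l j
    by (simp add: coeff_map_poly op_eval_0 vs.additive_scale)
  then show ?thesis
    by (intro poly_eqI[of X Y] poly_eqI_W) simp
qed

lemma product_eqI:
  "f = g" if "\<And>n m a b c. W n (prod_at f m a b) c = W n (prod_at g m a b) c"
  by (intro ext poly_eqI_W) (rule that[unfolded prod_at_def])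

text \<open>
  A family of functionals \<open>c \<mapsto> G c\<close> that depends polynomially on \<open>\<mu>\<close>, with \<open>\<partial>\<close> acting on \<open>c\<close> as
  \<open>\<lambda>\<close>, is represented by a polynomial in \<open>\<mu>\<close> over the module. The coefficient of each power of \<open>\<mu>\<close>
  lies in the conformal dual and so is represented by an element. Only finitely many powers
  occur: the degree in \<open>\<mu>\<close> is bounded on a finite generating set, and the elements satisfying a
  given bound form a submodule.
\<close>

lemma W_represents:
  fixes G :: "'a \<Rightarrow> 'k poly poly"
  assumes add: "\<And>l m c d. eval2 (*) l m (G (c + d)) = eval2 (*) l m (G c) + eval2 (*) l m (G d)"
    and hom: "\<And>l m k c. eval2 (*) l m (G (s k c)) = k * eval2 (*) l m (G c)"
    and D: "\<And>l m c. eval2 (*) l m (G (D scale c)) = l * eval2 (*) l m (G c)"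
  shows "\<exists>p. \<forall>l m c. W l (op_eval (s m) p) c = eval2 (*) l m (G c)"
proof -
  have G_add: "G (c + d) = G c + G d" for c d
    unfolding poly_poly_eq_iff_eval2 using add by (simp add: eval2_add)
  have G_s: "G (s k c) = map_poly (map_poly ((*) k)) (G c)" for k c
    unfolding poly_poly_eq_iff_eval2
    using hom by (simp add: kvs.eval2_coeffwise[OF kvs.additive_scale] mult.left_commute)
  have G_D: "G (D scale c) = lam (G c)" for c
    unfolding poly_poly_eq_iff_eval2 using D by (simp add: kvs.eval2_lam)
  define g where "g n c = coeff (G c) n" for n c
  have g_s: "g n (s k c) = smult k (g n c)" for n k c
    by (simp add: g_def G_s coeff_map_poly smult_conv_map_poly_fun)
  have g_D: "g n (D scale c) = [:0, 1:] * g n c" for n c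
    by (simp add: g_def G_D lam_def coeff_map_poly)
  have g_add: "g n (c + d) = g n c + g n d" for n c d
    by (simp add: g_def G_add)
  have "g n \<in> conformal_dual scale" for n
    using form g_s g_D g_add
    by (simp add: conformal_dual_def conformal_form_def Vector_Spaces.linear_iff)
  moreover have "\<omega> ` UNIV = conformal_dual scale"
    using nondegenerate by (simp add: nondegenerate_form_def bij_betw_def)
  ultimately have "\<forall>n. \<exists>y. \<omega> y = g n"
    by (metis imageE)
  then obtain y where y: "\<And>n. \<omega> (y n) = g n"
    by metis
  obtain A where A: "finite A" "span A = UNIV"
    using finitely_generated by blast
  define N where "N = Max (insert 0 ((degree \<circ> G) ` A))"
  have N: "degree (G c) \<le> N" if "c \<in> A" for c
    using that A(1) by (simp add: N_def)
  define Z where "Z = {c. \<forall>n>N. g n c = 0}"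
  have Z0: "0 \<in> Z" using g_add[of _ 0 0] by (simp add: Z_def)
  have Z_scale: "scale p c \<in> Z" if c: "c \<in> Z" for p c
  proof (induction p)
    case 0
    then show ?case by (simp add: Z0)
  next
    case (pCons k p)
    have "scale (pCons k p) c = s k c + D scale (scale p c)"
      by (simp add: D_def flip: scale_left_distrib)
    with pCons c show ?case by (simp add: Z_def g_add g_s g_D)
  qed
  have "subspace Z"
    by (rule subspaceI) (simp_all add: Z0 Z_scale, simp add: Z_def g_add)
  moreover have "A \<subseteq> Z"
    using N by (force simp: Z_def g_def intro: coeff_eq_0)
  ultimately have Z: "g n c = 0" if "n > N" for n c
    using span_minimal[of A Z] A(2) that by (auto simp: Z_def)
  have y0: "y n = 0" if "n > N" for n
    by (rule W_eqI) (simp add: W_def y Z that additive.zero[OF W_left, unfolded W_def])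
  define p where "p = Abs_poly y"
  have p: "coeff p n = y n" for n
    unfolding p_def by (subst coeff_Abs_poly[of N]) (simp_all add: y0)
  have "W l (op_eval (s m) p) c = eval2 (*) l m (G c)" for l m c
  proof -
    have "op_eval (s m) p = (\<Sum>n\<le>N. s (m ^ n) (y n))"
      by (subst op_eval_bound[OF vs.additive_scale, of _ N])
        (simp_all add: degree_le p y0 vs.funpow_scale)
    then have "W l (op_eval (s m) p) c = (\<Sum>n\<le>N. m ^ n * poly (g n c) l)"
      by (simp add: additive.sum[OF W_left] W_s_left) (simp add: W_def y)
    moreover have "degree (G c) \<le> N"
      by (rule degree_le) (simp add: Z[unfolded g_def])
    then have "degree (map_poly (op_eval ((*) l)) (G c)) \<le> N"
      using map_poly_degree_leq order_trans by blast
    then have "eval2 (*) l m (G c) = (\<Sum>n\<le>N. m ^ n * poly (g n c) l)"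
      unfolding eval2_def
      by (subst op_eval_bound[OF kvs.additive_scale])
        (simp_all add: coeff_map_poly op_eval_mult kvs.funpow_scale g_def)
    ultimately show ?thesis by simp
  qed
  then show ?thesis by blast
qed

lemma product_represents:
  fixes G :: "'a \<Rightarrow> 'a \<Rightarrow> 'a \<Rightarrow> 'k poly poly" and h :: "'k \<Rightarrow> 'k \<Rightarrow> 'a \<Rightarrow> 'a \<Rightarrow> 'a \<Rightarrow> 'k"
  assumes eval: "\<And>a b c l m. eval2 (*) l m (G a b c) = h l m a b c"
    and "\<And>a b c d l m. h l m a b (c + d) = h l m a b c + h l m a b d"
    and "\<And>a b c k l m. h l m a b (s k c) = k * h l m a b c"
    and "\<And>a b c l m. h l m a b (D scale c) = l * h l m a b c"
  shows "\<exists>!f. \<forall>n m a b c. W n (prod_at f m a b) c = h n m a b c"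
proof -
  have "\<exists>p. \<forall>l m c. W l (op_eval (s m) p) c = eval2 (*) l m (G a b c)" for a b
    by (rule W_represents) (simp_all add: assms)
  then obtain f where "\<And>a b l m c. W l (op_eval (s m) (f a b)) c = h l m a b c"
    unfolding eval by metis
  then show ?thesis
    by (intro ex1I[of _ f]) (auto simp: prod_at_def[symmetric] intro: product_eqI)
qed

lemma W_right_shifted: "W n a (op_eval (shifted l) p) = W n a (op_eval (s (- l - n)) p)"
  by (rule op_eval_shifted) (simp_all add: W_right W_s_right W_D_right)

lemma lhd_equation_iff: "lhd_equation pr \<omega> f \<longleftrightarrow>
    (\<forall>n m a b c. W n (prod_at f m a b) c = W m a (prod_at pr (- n) c b))"
  by (simp add: lhd_equation_def poly_poly_eq_iff_eval2 eval2_form eval2_const_product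
      eval2_product[OF pr_product] vs.eval2_const) blast

lemma eval2_rhd: "eval2 (*) n m
    (- (\<kappa> b \<star>\<^bsub>\<omega>,lam - mu\<^esub> (\<kappa> a \<star>\<^bsub>pr,mu\<^esub> \<kappa> c - \<kappa> c \<star>\<^bsub>pr, - mu - del scale\<^esub> \<kappa> a)))
  = W (n - m) b (prod_at pr (- n) c a) - W (n - m) b (prod_at pr m a c)"
  by (simp add: eval2_add eval2_form eval2_product[OF pr_product] vs.eval2_const
      additive.diff[OF W_right] W_right_shifted flip: prod_at_def)

lemma rhd_equation_iff: "rhd_equation scale pr \<omega> f \<longleftrightarrow>
    (\<forall>n m a b c. W n (prod_at f m a b) c
      = W (n - m) b (prod_at pr (- n) c a) - W (n - m) b (prod_at pr m a c))"
  by (simp add: rhd_equation_def poly_poly_eq_iff_eval2 eval2_form eval2_const_product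
      eval2_rhd vs.eval2_const) blast

lemmas pr_at_simps = prod_at_s_left[OF pr_product] prod_at_s_right[OF pr_product]
   prod_at_D_left[OF pr_product] prod_at_D_right[OF pr_product] 

lemmas W_at_simps = wpl.W_simps wpl.P_simps pr_at_simps W_s_left W_s_right W_D_left W_D_right

text \<open>In both cases the right side of the defining equation is linear in \<open>c\<close>, with \<open>\<partial>\<close> acting as \<open>\<lambda>\<close>.\<close>

lemma ex1_lhd: "\<exists>!f. lhd_equation pr \<omega> f"
  unfolding lhd_equation_iff
proof (rule product_represents)
  show "eval2 (*) l m (\<kappa> a \<star>\<^bsub>\<omega>,mu\<^esub> (\<kappa> c \<star>\<^bsub>pr, - lam\<^esub> \<kappa> b)) = W m a (prod_at pr (- l) c b)"
    for l m a b c
    by (simp add: eval2_form eval2_product[OF pr_product] vs.eval2_const)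
qed (simp_all add: W_at_simps algebra_simps)

lemma ex1_rhd: "\<exists>!f. rhd_equation scale pr \<omega> f"
  unfolding rhd_equation_iff
  by (rule product_represents[OF eval2_rhd]) (simp_all add: W_at_simps algebra_simps)

text \<open>
  In the last hypothesis \<open>m - n\<close> is the value of \<open>\<lambda> + \<partial>\<close>: the variable of the product has the value
  \<open>m\<close>, and \<open>\<partial>\<close> on the first argument of the form acts as \<open>- n\<close>.
\<close>

lemma conformal_product_W:
  assumes "\<And>n m a a' b c. W n (prod_at f m (a + a') b) c = W n (prod_at f m a b) c + W n (prod_at f m a' b) c"
    and "\<And>n m a b b' c. W n (prod_at f m a (b + b')) c = W n (prod_at f m a b) c + W n (prod_at f m a b') c"
    and "\<And>n m k a b c. W n (prod_at f m (s k a) b) c = k * W n (prod_at f m a b) c"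
    and "\<And>n m k a b c. W n (prod_at f m a (s k b)) c = k * W n (prod_at f m a b) c"
    and "\<And>n m a b c. W n (prod_at f m (D scale a) b) c = - m * W n (prod_at f m a b) c"
    and "\<And>n m a b c. W n (prod_at f m a (D scale b)) c = (m - n) * W n (prod_at f m a b) c"
  shows "conformal_product scale f"
proof -
  have "vector_space (\<lambda>k. map_poly (s k))"
    using br_product by (simp add: conformal_product_def Vector_Spaces.linear_iff)
  moreover
  note eval = additive.add[OF vs.additive_eval] additive.minus[OF vs.additive_eval]
    op_eval_pCons[OF vs.additive_scale] s_op_eval[symmetric] D_op_eval[symmetric]
    wpl.W_simps W_s_left W_D_left
  have "f (a + a') b = f a b + f a' b" "f a (b + b') = f a b + f a b'"
    "f (s k a) b = map_poly (s k) (f a b)" "f a (s k b) = map_poly (s k) (f a b)"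
    "f (D scale a) b = - pCons 0 (f a b)" 
    "f a (D scale b) = pCons 0 (f a b) + map_poly (D scale) (f a b)" for a a' b b' k
    using assms by (auto intro!: poly_eqI_W simp: eval prod_at_def algebra_simps)
  ultimately show ?thesis
    using vs.vector_space_axioms by (simp add: conformal_product_def Vector_Spaces.linear_iff)
qed

end

section \<open>The adjoint products\<close>

locale adjoint_products = generalized_pseudo_hessian scale br pr \<omega>
  for scale :: "'k::field_char_0 poly \<Rightarrow> 'a::ab_group_add \<Rightarrow> 'a"
    and br pr :: "'a \<Rightarrow> 'a \<Rightarrow> 'a poly" and \<omega> :: "'a \<Rightarrow> 'a \<Rightarrow> 'k poly" +
  fixes lhd rhd :: "'a \<Rightarrow> 'a \<Rightarrow> 'a poly"
  assumes lhd: "lhd_equation pr \<omega> lhd" and rhd: "rhd_equation scale pr \<omega> rhd"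
begin

sublocale wa: weighted_adjoint "prod_at br" "prod_at pr" W "prod_at lhd" "prod_at rhd"
  using lhd rhd by unfold_locales (simp_all add: lhd_equation_iff rhd_equation_iff)

lemma lhd_product: "conformal_product scale lhd"
  by (rule conformal_product_W) (simp_all add: wa.W_L W_at_simps algebra_simps)

lemma rhd_product: "conformal_product scale rhd"
  by (rule conformal_product_W) (simp_all add: wa.W_R W_at_simps algebra_simps)

lemma rhd_plus_lhd: "prod_at rhd m a b + prod_at lhd m a b = prod_at pr m a b"
  by (rule W_eqI) (simp add: wpl.W_simps wa.W_R_L)

lemma rhd_plus_lhd_poly: "rhd a b + lhd a b = pr a b"
  by (rule poly_eqI_W)
    (simp add: additive.add[OF vs.additive_eval] rhd_plus_lhd flip: prod_at_def)

text \<open>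
  The next three lemmas resolve \<open>- k - \<partial>\<close> inside a further product. There \<open>\<partial>\<close> has to pass the
  outer product first and picks up the index of that product.
\<close>

lemma W_product_shifted:
  assumes f: "conformal_product scale f"
  shows "W n (prod_at f l a (op_eval (shifted k) p)) d = W n (prod_at f l a (op_eval (s (n - l - k)) p)) d"
proof -
  note lin = additive.add[OF prod_at_right[OF f]] prod_at_s_right[OF f] prod_at_D_right[OF f]
  show ?thesis
    using op_eval_shifted[of "\<lambda>x. W n (prod_at f l a x) d" "l - n" k p]
    by (simp add: additive_def lin wpl.W_simps W_s_left W_D_left algebra_simps)
qed

lemma W_pr_shifted_left: "W k c (prod_at pr j (op_eval (shifted l) p) d) = W k c (prod_at pr j (op_eval (s (j - l)) p) d)"
  using op_eval_shifted[of "\<lambda>x. W k c (prod_at pr j x d)" "- j" l p]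
  by (simp add: additive_def W_at_simps algebra_simps)

lemma W_pr_shifted_right: "W k c (prod_at pr j d (op_eval (shifted l) p)) = W k c (prod_at pr j d (op_eval (s (- l - j - k)) p))"
  using op_eval_shifted[of "\<lambda>x. W k c (prod_at pr j d x)" "j + k" l p]
  by (simp add: additive_def W_at_simps algebra_simps)

lemmas eval_simps = eval2_product[OF br_product] eval2_product[OF lhd_product]
  eval2_product[OF rhd_product] eval2_add vs.eval2_const wpl.W_simps

lemmas shift_simps = W_shifted W_product_shifted[OF br_product] prod_at_def[symmetric]

lemma pp4_bracket: "W n (prod_at rhd (l + m) (eval2 s l m (pp_bracket scale br lhd rhd a b)) c) d
  = W (n - l - m) c (prod_at pr (- n) d (prod_at pr l a b))
    - W (n - l - m) c (prod_at pr (- n) d (prod_at pr m b a))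
    + W (n - l - m) c (prod_at pr (- n) d (prod_at br l a b))
    - W (n - l - m) c (prod_at pr (l + m) (prod_at pr l a b) d)
    + W (n - l - m) c (prod_at pr (l + m) (prod_at pr m b a) d)
    - W (n - l - m) c (prod_at pr (l + m) (prod_at br l a b) d)"
proof -
  have "eval2 s l m (pp_bracket scale br lhd rhd a b)
    = prod_at pr l a b - op_eval (shifted l) (pr b a) + prod_at br l a b"
    by (simp add: pp_bracket_def eval_simps flip: rhd_plus_lhd rhd_plus_lhd_poly)
      (simp add: additive.add[OF additive_op_eval[OF additive_shifted]])
  note bracket = this
  show ?thesis
    unfolding bracket
    by (simp add: wa.W_R W_at_simps W_pr_shifted_left W_pr_shifted_right algebra_simps
        flip: prod_at_def)
qed

sublocale pp: pp_post_lie_conformal_algebra scale br lhd rhd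
proof
  show "conformal_product scale lhd" "conformal_product scale rhd"
    by (fact lhd_product rhd_product)+
  fix a b c
  show "\<kappa> a \<star>\<^bsub>lhd,lam\<^esub> (\<kappa> b \<star>\<^bsub>br,mu\<^esub> \<kappa> c) =
      (\<kappa> a \<star>\<^bsub>br,lam\<^esub> \<kappa> b) \<star>\<^bsub>lhd,lam + mu\<^esub> \<kappa> c
      - (\<kappa> a \<star>\<^bsub>br,lam\<^esub> \<kappa> c) \<star>\<^bsub>lhd, - mu - del scale\<^esub> \<kappa> b"
    by (rule poly_poly_eqI_W) (simp only: eval_simps shift_simps wa.pp1)
  show "\<kappa> a \<star>\<^bsub>br,lam\<^esub> (\<kappa> b \<star>\<^bsub>lhd,mu\<^esub> \<kappa> c + \<kappa> c \<star>\<^bsub>lhd, - mu - del scale\<^esub> \<kappa> b) =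
      (\<kappa> a \<star>\<^bsub>br,lam\<^esub> \<kappa> c) \<star>\<^bsub>lhd, - mu - del scale\<^esub> \<kappa> b
      + \<kappa> b \<star>\<^bsub>lhd,mu\<^esub> (\<kappa> a \<star>\<^bsub>br,lam\<^esub> \<kappa> c)"
    by (rule poly_poly_eqI_W)
      (simp only: eval_simps additive.add[OF prod_at_right[OF br_product]] shift_simps wa.pp2)
  show "\<kappa> a \<star>\<^bsub>rhd,lam\<^esub> (\<kappa> b \<star>\<^bsub>br,mu\<^esub> \<kappa> c)
      - (\<kappa> b \<star>\<^bsub>br,mu\<^esub> \<kappa> c) \<star>\<^bsub>lhd, - lam - del scale\<^esub> \<kappa> a =
      (\<kappa> a \<star>\<^bsub>rhd,lam\<^esub> \<kappa> b + \<kappa> a \<star>\<^bsub>lhd,lam\<^esub> \<kappa> b) \<star>\<^bsub>br,lam + mu\<^esub> \<kappa> c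
      + \<kappa> b \<star>\<^bsub>br,mu\<^esub> (\<kappa> a \<star>\<^bsub>rhd,lam\<^esub> \<kappa> c - \<kappa> c \<star>\<^bsub>lhd, - lam - del scale\<^esub> \<kappa> a)"
    by (rule poly_poly_eqI_W)
      (simp only: eval_simps rhd_plus_lhd additive.diff[OF prod_at_right[OF br_product]]
        shift_simps wa.pp3 add_diff_eq)
  show "pp_bracket scale br lhd rhd a b \<star>\<^bsub>rhd,lam + mu\<^esub> \<kappa> c =
      \<kappa> a \<star>\<^bsub>rhd,lam\<^esub> (\<kappa> b \<star>\<^bsub>rhd,mu\<^esub> \<kappa> c) - \<kappa> b \<star>\<^bsub>rhd,mu\<^esub> (\<kappa> a \<star>\<^bsub>rhd,lam\<^esub> \<kappa> c)
      + \<kappa> b \<star>\<^bsub>br,mu\<^esub> (\<kappa> a \<star>\<^bsub>lhd,lam\<^esub> \<kappa> c) - \<kappa> a \<star>\<^bsub>br,lam\<^esub> (\<kappa> b \<star>\<^bsub>lhd,mu\<^esub> \<kappa> c)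
      - (\<kappa> a \<star>\<^bsub>br,lam\<^esub> \<kappa> b) \<star>\<^bsub>lhd,lam + mu\<^esub> \<kappa> c"
    by (rule poly_poly_eqI_W) (simp only: eval_simps pp4_bracket wa.pp4)
  show "(\<kappa> a \<star>\<^bsub>rhd,lam\<^esub> \<kappa> b - \<kappa> b \<star>\<^bsub>lhd,mu\<^esub> \<kappa> a) \<star>\<^bsub>lhd,lam + mu\<^esub> \<kappa> c
      + \<kappa> b \<star>\<^bsub>lhd,mu\<^esub> (\<kappa> a \<star>\<^bsub>rhd,lam\<^esub> \<kappa> c + \<kappa> a \<star>\<^bsub>lhd,lam\<^esub> \<kappa> c) =
      \<kappa> a \<star>\<^bsub>rhd,lam\<^esub> (\<kappa> b \<star>\<^bsub>lhd,mu\<^esub> \<kappa> c) + \<kappa> a \<star>\<^bsub>br,lam\<^esub> (\<kappa> b \<star>\<^bsub>lhd,mu\<^esub> \<kappa> c)"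
    by (rule poly_poly_eqI_W)
      (simp only: eval_simps rhd_plus_lhd additive.diff[OF prod_at_left[OF lhd_product]] wa.pp5)
qed

text \<open>
  The symmetrization of \<open>\<lhd>\<close> pairs to \<open>S\<close>, and left-invariance makes \<open>S\<close> vanish.
\<close>

lemma special:
  assumes "left_invariant_form br pr \<omega>"
  shows "special_pp_post_lie_conformal_algebra scale br lhd rhd"
proof
  fix a b
  have P: "W (l + m) (prod_at pr l a b) c + W m b (prod_at pr l a c) = 0" for l m a b c
    using arg_cong[OF assms[unfolded left_invariant_form_def, THEN conjunct2, rule_format,
        of a b c], of "eval2 (*) l m"]
    by (simp add: eval2_add eval2_form eval2_product[OF pr_product] vs.eval2_const
        additive.zero[OF kvs.additive_eval2])
  have "W n (prod_at lhd m a b) c + W n (prod_at lhd (n - m) b a) c = 0" for n m a b c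
    unfolding wa.W_L_sym wpl.S_def by (rule P)
  then show "\<kappa> a \<star>\<^bsub>lhd,lam\<^esub> \<kappa> b = - (\<kappa> b \<star>\<^bsub>lhd, - lam - del scale\<^esub> \<kappa> a)"
    by (intro poly_poly_eqI_W)
      (simp only: eval_simps shift_simps eq_neg_iff_add_eq_0)
qed

end

theorem proposition3p37:
  fixes scale :: "'k::field_char_0 poly \<Rightarrow> 'a::ab_group_add \<Rightarrow> 'a"
    and br pr :: "'a \<Rightarrow> 'a \<Rightarrow> 'a poly"
    and \<omega> :: "'a \<Rightarrow> 'a \<Rightarrow> 'k poly"
  assumes "generalized_pseudo_hessian scale br pr \<omega>"
  shows "(\<exists>!lhd. lhd_equation pr \<omega> lhd) \<and> (\<exists>!rhd. rhd_equation scale pr \<omega> rhd) \<and>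
    (\<forall>lhd rhd. lhd_equation pr \<omega> lhd \<and> rhd_equation scale pr \<omega> rhd \<longrightarrow>
      pp_post_lie_conformal_algebra scale br lhd rhd \<and>
      (left_invariant_form br pr \<omega> \<longrightarrow>
        special_pp_post_lie_conformal_algebra scale br lhd rhd))"
proof -
  interpret generalized_pseudo_hessian scale br pr \<omega> by fact
  have "pp_post_lie_conformal_algebra scale br lhd rhd \<and>
      (left_invariant_form br pr \<omega> \<longrightarrow> special_pp_post_lie_conformal_algebra scale br lhd rhd)"
    if "lhd_equation pr \<omega> lhd" "rhd_equation scale pr \<omega> rhd" for lhd rhd
  proof -
    interpret adjoint_products scale br pr \<omega> lhd rhd
      by unfold_locales (fact that)+
    show ?thesis
      using pp.pp_post_lie_conformal_algebra_axioms special by blast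
  qed
  then show ?thesis using ex1_lhd ex1_rhd by blast
qed

end
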